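(* Let $\Bbbk$ be a field, $n\ge2$, let $P_1,\dots,P_n$ be distinct $\Bbbk$-rational points of $\mathbb{P}^1_{\Bbbk}$, and let $D=\sum_{i=1}^n\alpha_iP_i$ with $\alpha_i\in\mathbb{Q}$ and $\deg D=\sum_i\alpha_i>0$. Write $\alpha_i=p_i/q_i$ in lowest terms ($q_i>0$), and let $$\ell=\operatorname{lcm}_{1\le j\le n}q_j,\qquad \ell_i=\operatorname{lcm}_{j\ne i}q_j .$$ Then the canonical ring $S=S_D$ is generated in degrees less than $\sum_i\ell_i$, with relations in degrees less than $$\max\Big\{\ell+\sum_i\ell_i,\ 2\sum_i\ell_i\Big\}.$$ That is, there is a graded presentation $S\cong\Bbbk[x_1,\dots,x_N]/I$ in which every $x_j$ is homogeneous of degree less than $\sum_i\ell_i$ and the homogeneous ideal $I$ is generated by homogeneous elements of degree less than $\max\{\ell+\sum_i\ell_i,\,2\sum_i\ell_i\}$.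
   Context: For a $\mathbb{Q}$-divisor $D=\sum_i\alpha_iP_i$ on $\mathbb{P}^1_{\Bbbk}$, put $\lfloor dD\rfloor=\sum_i\lfloor d\alpha_i\rfloor P_i$. The canonical ring of $D$ is the graded $\Bbbk$-algebra $S_D=\bigoplus_{d\ge0}u^dH^0(\mathbb{P}^1,O(\lfloor dD\rfloor))\subseteq \Bbbk(t)[u]$, where $t$ is the rational coordinate on $\mathbb{P}^1$, $H^0(\mathbb{P}^1,O(E))$ is the space of rational functions $f$ with $f=0$ or $\operatorname{div}(f)+E\ge0$, and $u$ is a dummy variable recording the degree. *)

theory Defs
  imports
    "HOL-Computational_Algebra.Polynomial_Factorial"
    "HOL-Computational_Algebra.Fraction_Field"
    "HOL-Library.Poly_Mapping"
    "HOL-Algebra.QuotRing"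
begin

section \<open>Rings carried by subrings of a type\<close>

definition ring_on :: "'a::comm_ring_1 set \<Rightarrow> 'a ring" where
  "ring_on C = \<lparr>carrier = C, mult = (*), one = 1, zero = 0, add = (+)\<rparr>"

lemma cring_ring_on:
  assumes "0 \<in> C" "1 \<in> C"
    and "\<And>x y. x \<in> C \<Longrightarrow> y \<in> C \<Longrightarrow> x + y \<in> C"
    and "\<And>x y. x \<in> C \<Longrightarrow> y \<in> C \<Longrightarrow> x * y \<in> C"
    and "\<And>x. x \<in> C \<Longrightarrow> - x \<in> C"
  shows "cring (ring_on C)"
proof (rule cringI)
  show "abelian_group (ring_on C)"
  proof (rule abelian_groupI)
    fix x assume "x \<in> carrier (ring_on C)"
    then have "- x \<in> carrier (ring_on C)" "- x \<oplus>\<^bsub>ring_on C\<^esub> x = \<zero>\<^bsub>ring_on C\<^esub>"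
      using assms by (simp_all add: ring_on_def)
    then show "\<exists>y\<in>carrier (ring_on C). y \<oplus>\<^bsub>ring_on C\<^esub> x = \<zero>\<^bsub>ring_on C\<^esub>" by blast
  qed (use assms in \<open>auto simp: ring_on_def algebra_simps\<close>)
  show "Group.comm_monoid (ring_on C)"
    by (rule comm_monoidI) (use assms in \<open>auto simp: ring_on_def algebra_simps\<close>)
qed (auto simp: ring_on_def algebra_simps)


section \<open>Closed points of the projective line and orders of rational functions\<close>

text \<open>
  The field \<open>k(t)\<close> is \<^typ>\<open>'k poly fract\<close>.  The closed points of the projective line over \<open>k\<close>
  are the point at infinity and the monic irreducible polynomials in \<open>t\<close>; the point \<open>t = a\<close>
  corresponds to \<open>t - a\<close>.  Non-rational closed points are needed since \<open>div(f)\<close> of a rational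
  function is in general not supported on rational points.
\<close>

text \<open>The parameter \<open>'p\<close> is always instantiated with \<open>'k poly\<close>.\<close>

datatype 'p place = Finite_Place 'p | Infinite_Place

definition closed_points :: "'k::field poly place set" where
  "closed_points = insert Infinite_Place (Finite_Place ` {p. irreducible p \<and> lead_coeff p = 1})"

definition rational_points :: "'k::field poly place set" where
  "rational_points = insert Infinite_Place (range (\<lambda>a. Finite_Place [:- a, 1:]))"

text \<open>
  The order of a nonzero polynomial.  The library's \<open>multiplicity\<close> is written out, since
  its type class is not available for polynomials over an arbitrary field.
\<close>

fun poly_ord :: "'k::field poly place \<Rightarrow> 'k poly \<Rightarrow> int" where
  "poly_ord (Finite_Place p) a = int (Max {n. p ^ n dvd a})"
| "poly_ord Infinite_Place a = - int (degree a)"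

text \<open>The coefficient at \<open>x\<close> of \<open>div(f)\<close>; only meaningful for nonzero \<open>f\<close>.\<close>

definition ord_at :: "'k::field poly place \<Rightarrow> 'k poly fract \<Rightarrow> int" where
  "ord_at x f = (THE m. \<exists>a b. a \<noteq> 0 \<and> b \<noteq> 0 \<and> f = Fract a b \<and> m = poly_ord x a - poly_ord x b)"

definition H0 :: "('k::field poly place \<Rightarrow> int) \<Rightarrow> 'k poly fract set" where
  "H0 E = {f. f = 0 \<or> (\<forall>x\<in>closed_points. ord_at x f + E x \<ge> 0)}"


section \<open>The canonical ring of a rational divisor\<close>

definition point_divisor :: "nat \<Rightarrow> (nat \<Rightarrow> 'k::field poly place) \<Rightarrow> (nat \<Rightarrow> rat) \<Rightarrow> 'k poly place \<Rightarrow> rat" where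
  "point_divisor n P \<alpha> = (\<lambda>x. \<Sum>i\<in>{i\<in>{1..n}. P i = x}. \<alpha> i)"

definition floor_multiple :: "nat \<Rightarrow> ('k::field poly place \<Rightarrow> rat) \<Rightarrow> 'k poly place \<Rightarrow> int" where
  "floor_multiple d D = (\<lambda>x. \<lfloor>of_nat d * D x\<rfloor>)"

text \<open>
  The ring \<open>k(t)[u]\<close> is \<^typ>\<open>'k poly fract poly\<close>, with \<open>u\<close> the polynomial variable.
\<close>

definition canonical_piece :: "('k::field poly place \<Rightarrow> rat) \<Rightarrow> nat \<Rightarrow> 'k poly fract poly set" where
  "canonical_piece D d = (\<lambda>f. Polynomial.monom f d) ` H0 (floor_multiple d D)"

definition canonical_ring :: "('k::field poly place \<Rightarrow> rat) \<Rightarrow> 'k poly fract poly ring" where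
  "canonical_ring D = ring_on {F. \<forall>d. coeff F d \<in> H0 (floor_multiple d D)}"


section \<open>Weighted polynomial rings\<close>

text \<open>
  \<^typ>\<open>(nat \<Rightarrow>\<^sub>0 nat) \<Rightarrow>\<^sub>0 'k\<close> is the polynomial ring over \<open>k\<close> in variables \<open>x\<^sub>0, x\<^sub>1, \<dots>\<close>: the monomial
  \<open>m\<close> has exponent \<open>Poly_Mapping.lookup m j\<close> at \<open>x\<^sub>j\<close>.  The ring in \<open>N\<close> variables uses \<open>x\<^sub>0, \<dots>, x\<^sub>N\<^sub>-\<^sub>1\<close> only.
\<close>

type_synonym 'k mpoly = "(nat \<Rightarrow>\<^sub>0 nat) \<Rightarrow>\<^sub>0 'k"

definition mpoly_ring :: "nat \<Rightarrow> 'k::field mpoly ring" where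
  "mpoly_ring N = ring_on {f. \<forall>m\<in>Poly_Mapping.keys f. Poly_Mapping.keys m \<subseteq> {..<N}}"

definition mpoly_const :: "'k::field \<Rightarrow> 'k mpoly" where
  "mpoly_const c = Poly_Mapping.single 0 c"

text \<open>The homogeneous polynomials of degree \<open>e\<close> (including \<open>0\<close>) when \<open>x\<^sub>j\<close> has degree \<open>w j\<close>.\<close>

definition mpoly_piece :: "nat \<Rightarrow> (nat \<Rightarrow> nat) \<Rightarrow> nat \<Rightarrow> 'k::field mpoly set" where
  "mpoly_piece N w e =
    {f \<in> carrier (mpoly_ring N). \<forall>m\<in>Poly_Mapping.keys f.
      (\<Sum>j\<in>Poly_Mapping.keys m. Poly_Mapping.lookup m j * w j) = e}"

text \<open>
  Isomorphisms \<open>k[x\<^sub>0, \<dots>, x\<^sub>N\<^sub>-\<^sub>1]/I \<cong> S\<^sub>D\<close> of graded \<open>k\<close>-algebras, where \<open>x\<^sub>j\<close> has degree \<open>w j\<close>.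
  The degree \<open>e\<close> part of the quotient is the image of the degree \<open>e\<close> part of the polynomial ring.
\<close>

definition graded_isos ::
    "nat \<Rightarrow> (nat \<Rightarrow> nat) \<Rightarrow> 'k::field mpoly set \<Rightarrow> ('k poly place \<Rightarrow> rat)
      \<Rightarrow> ('k mpoly set \<Rightarrow> 'k poly fract poly) set" where
  "graded_isos N w I D =
    {h \<in> ring_iso (mpoly_ring N Quot I) (canonical_ring D).
      (\<forall>c. h (I +>\<^bsub>mpoly_ring N\<^esub> mpoly_const c) = [:Fract [:c:] 1:]) \<and>
      (\<forall>e. (\<lambda>f. h (I +>\<^bsub>mpoly_ring N\<^esub> f)) ` mpoly_piece N w e = canonical_piece D e)}"


section \<open>Well-definedness\<close>

lemma rational_points_closed: "rational_points \<subseteq> (closed_points :: 'k::field poly place set)"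
  by (auto simp: rational_points_def closed_points_def intro!: irreducible_linear_field_poly)

lemma point_divisor_at:
  assumes "inj_on P {1..n}" "i \<in> {1..n}"
  shows "point_divisor n P \<alpha> (P i) = \<alpha> i"
proof -
  have "{j\<in>{1..n}. P j = P i} = {i}"
    using assms unfolding inj_on_def by blast
  then show ?thesis by (simp add: point_divisor_def)
qed

lemma
  fixes p a :: "'k::field poly"
  assumes "irreducible p" "a \<noteq> 0"
  shows finite_dvd_powers: "finite {n. p ^ n dvd a}"
    and Max_dvd_power: "p ^ Max {n. p ^ n dvd a} dvd a"
    and dvd_power_le_Max: "p ^ n dvd a \<Longrightarrow> n \<le> Max {n. p ^ n dvd a}"
proof -
  have "p \<noteq> 0" "\<not> is_unit p"
    using assms(1) by (simp_all add: irreducible_def)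
  then have "degree p > 0"
    by (simp add: is_unit_iff_degree)
  have "n \<le> degree a" if "p ^ n dvd a" for n
  proof -
    have "n * degree p \<le> degree a"
      using dvd_imp_degree_le[OF that assms(2)] degree_power_eq[OF \<open>p \<noteq> 0\<close>, of n] by linarith
    moreover have "n * 1 \<le> n * degree p"
      using \<open>degree p > 0\<close> by (intro mult_le_mono2) linarith
    ultimately show ?thesis by linarith
  qed
  then show fin: "finite {n. p ^ n dvd a}"
    by (metis bounded_nat_set_is_finite le_imp_less_Suc mem_Collect_eq)
  have "0 \<in> {n. p ^ n dvd a}" by simp
  then show "p ^ Max {n. p ^ n dvd a} dvd a"
    using Max_in[OF fin] by blast
  show "p ^ n dvd a \<Longrightarrow> n \<le> Max {n. p ^ n dvd a}"
    by (rule Max_ge[OF fin CollectI])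
qed

lemma Max_dvd_power_decomp:
  fixes p a :: "'k::field poly"
  assumes "irreducible p" "a \<noteq> 0"
  obtains a' where "a = p ^ Max {n. p ^ n dvd a} * a'" "\<not> p dvd a'"
proof -
  define i where "i = Max {n. p ^ n dvd a}"
  obtain a' where a': "a = p ^ i * a'"
    using Max_dvd_power[OF assms] unfolding i_def by (elim dvdE)
  have "\<not> p dvd a'"
  proof
    assume "p dvd a'"
    then have "p ^ i * p dvd p ^ i * a'"
      by (rule mult_dvd_mono[OF dvd_refl])
    then have "p ^ Suc i dvd a"
      unfolding a' by (simp only: power_Suc2)
    then have "Suc i \<le> i"
      unfolding i_def by (rule dvd_power_le_Max[OF assms])
    then show False by simp
  qed
  with a' show ?thesis unfolding i_def by (rule that)
qed

lemma Max_dvd_powers_mult: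
  fixes p a b :: "'k::field poly"
  assumes p: "irreducible p" and a: "a \<noteq> 0" and b: "b \<noteq> 0"
  shows "Max {n. p ^ n dvd a * b} = Max {n. p ^ n dvd a} + Max {n. p ^ n dvd b}"
proof -
  define i j where "i = Max {n. p ^ n dvd a}" and "j = Max {n. p ^ n dvd b}"
  obtain a' where a': "a = p ^ i * a'" "\<not> p dvd a'"
    using Max_dvd_power_decomp[OF p a] unfolding i_def by blast
  obtain b' where b': "b = p ^ j * b'" "\<not> p dvd b'"
    using Max_dvd_power_decomp[OF p b] unfolding j_def by blast
  have p0: "p \<noteq> 0" using p by (auto simp: irreducible_def)
  have ab: "a * b = p ^ (i + j) * (a' * b')"
    by (subst a'(1), subst b'(1)) (simp add: power_add mult_ac)
  have nd: "\<not> p dvd a' * b'"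
    using a'(2) b'(2) field_poly_irreducible_imp_prime[OF p] by (simp add: prime_elem_dvd_mult_iff)
  have "Max {n. p ^ n dvd a * b} = i + j"
  proof (rule Max_eqI)
    show "finite {n. p ^ n dvd a * b}"
      using finite_dvd_powers[OF p, of "a * b"] a b by simp
    show "i + j \<in> {n. p ^ n dvd a * b}" by (simp add: ab)
    fix n assume n: "n \<in> {n. p ^ n dvd a * b}"
    show "n \<le> i + j"
    proof (rule ccontr)
      assume "\<not> n \<le> i + j"
      then have "p ^ Suc (i + j) dvd p ^ n" by (intro le_imp_power_dvd) simp
      also have "p ^ n dvd p ^ (i + j) * (a' * b')" using n ab by simp
      finally have "p ^ (i + j) * p dvd p ^ (i + j) * (a' * b')" by (simp add: mult.commute)
      then have "p dvd a' * b'" using p0 by simp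
      with nd show False by simp
    qed
  qed
  then show ?thesis by (simp add: i_def j_def)
qed

lemma poly_ord_mult:
  assumes "x \<in> closed_points" "a \<noteq> 0" "b \<noteq> 0"
  shows "poly_ord x (a * b) = poly_ord x a + poly_ord x b"
  using assms by (cases x) (auto simp: closed_points_def degree_mult_eq Max_dvd_powers_mult)

lemma poly_ord_add:
  assumes "x \<in> closed_points" "a \<noteq> 0" "b \<noteq> 0" "a + b \<noteq> 0"
  shows "poly_ord x (a + b) \<ge> min (poly_ord x a) (poly_ord x b)"
proof (cases x)
  case (Finite_Place p)
  with assms(1) have p: "irreducible p" by (auto simp: closed_points_def)
  define m where "m = min (Max {n. p ^ n dvd a}) (Max {n. p ^ n dvd b})"
  have "p ^ m dvd a"
    by (rule dvd_trans[OF le_imp_power_dvd Max_dvd_power[OF p assms(2)]]) (simp add: m_def)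
  moreover have "p ^ m dvd b"
    by (rule dvd_trans[OF le_imp_power_dvd Max_dvd_power[OF p assms(3)]]) (simp add: m_def)
  ultimately have "m \<le> Max {n. p ^ n dvd a + b}"
    by (intro dvd_power_le_Max[OF p assms(4)] dvd_add)
  then show ?thesis using Finite_Place by (simp add: m_def min_def split: if_splits)
next
  case Infinite_Place
  then show ?thesis using degree_add_le_max[of a b] by (auto simp: min_def max_def split: if_splits)
qed

lemma ord_at_Fract:
  assumes x: "x \<in> closed_points" and "a \<noteq> 0" "b \<noteq> 0"
  shows "ord_at x (Fract a b) = poly_ord x a - poly_ord x b"
  unfolding ord_at_def
proof (rule the_equality)
  show "\<exists>a' b'. a' \<noteq> 0 \<and> b' \<noteq> 0 \<and> Fract a b = Fract a' b' \<and>
      poly_ord x a - poly_ord x b = poly_ord x a' - poly_ord x b'"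
    using assms by blast
next
  fix m
  assume "\<exists>a' b'. a' \<noteq> 0 \<and> b' \<noteq> 0 \<and> Fract a b = Fract a' b' \<and> m = poly_ord x a' - poly_ord x b'"
  then obtain a' b' where *: "a' \<noteq> 0" "b' \<noteq> 0" "Fract a b = Fract a' b'"
    "m = poly_ord x a' - poly_ord x b'" by blast
  from * assms have "a * b' = a' * b" by (simp add: eq_fract)
  then have "poly_ord x (a * b') = poly_ord x (a' * b)" by simp
  with * assms show "m = poly_ord x a - poly_ord x b" by (simp add: poly_ord_mult)
qed

lemma fract_nonzeroE:
  fixes f :: "'k::field poly fract"
  assumes "f \<noteq> 0"
  obtains a b where "a \<noteq> 0" "b \<noteq> 0" "f = Fract a b"
  using assms by (cases f rule: Fract_cases_nonzero) auto

lemma ord_at_mult: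
  assumes "x \<in> closed_points" "f \<noteq> 0" "g \<noteq> 0"
  shows "ord_at x (f * g) = ord_at x f + ord_at x g"
proof -
  obtain a b where 1: "a \<noteq> 0" "b \<noteq> 0" "f = Fract a b" using assms(2) by (rule fract_nonzeroE)
  obtain c d where 2: "c \<noteq> 0" "d \<noteq> 0" "g = Fract c d" using assms(3) by (rule fract_nonzeroE)
  show ?thesis using 1 2 assms(1) by (simp add: ord_at_Fract poly_ord_mult)
qed

lemma ord_at_add:
  assumes x: "x \<in> closed_points" and "f \<noteq> 0" "g \<noteq> 0" and nz: "f + g \<noteq> 0"
  shows "ord_at x (f + g) \<ge> min (ord_at x f) (ord_at x g)"
proof -
  obtain a b where 1: "a \<noteq> 0" "b \<noteq> 0" "f = Fract a b" using assms(2) by (rule fract_nonzeroE)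
  obtain c d where 2: "c \<noteq> 0" "d \<noteq> 0" "g = Fract c d" using assms(3) by (rule fract_nonzeroE)
  have s: "f + g = Fract (a * d + c * b) (b * d)" using 1 2 by simp
  with nz have "a * d + c * b \<noteq> 0" by (metis fract_collapse(1))
  then show ?thesis
    using 1 2 x poly_ord_add[OF x, of "a * d" "c * b"]
    by (simp add: s[unfolded 1 2] ord_at_Fract poly_ord_mult min_def split: if_splits)
qed

lemma ord_at_const:
  fixes c :: "'k::field"
  assumes x: "x \<in> closed_points" and c: "c \<noteq> 0"
  shows "ord_at x (Fract [:c:] 1) = 0"
proof -
  have "poly_ord x 1 + poly_ord x 1 = poly_ord x 1"
    using poly_ord_mult[OF x, of 1 1] by simp
  moreover have "poly_ord x [:c:] = 0"
  proof (cases x)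
    case (Finite_Place p)
    then have p: "irreducible p" using x by (auto simp: closed_points_def)
    have "is_unit [:c:]" using c by (simp add: is_unit_iff_degree)
    then have "\<not> p dvd [:c:]" using p dvd_trans unfolding irreducible_def by blast
    then have "n = 0" if "p ^ n dvd [:c:]" for n
      using dvd_trans[OF dvd_power[of n p] that] by (cases n) auto
    then have "{n. p ^ n dvd [:c:]} = {0}" by auto
    then show ?thesis using Finite_Place by simp
  qed simp
  ultimately show ?thesis
    using assms by (simp add: ord_at_Fract)
qed

lemma ord_at_uminus:
  assumes "x \<in> closed_points" "f \<noteq> 0"
  shows "ord_at x (- f) = ord_at x f"
proof -
  have "- f = Fract [:- 1:] 1 * f"
    by (cases f) (simp add: pCons_one[symmetric])
  moreover have "Fract [:- 1:] 1 \<noteq> (0 :: 'a poly fract)"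
    by (simp add: Zero_fract_def eq_fract)
  ultimately show ?thesis
    using assms by (metis ord_at_mult ord_at_const add_0 neg_equal_0_iff_equal one_neq_zero)
qed

lemma H0_zero: "0 \<in> H0 E"
  by (simp add: H0_def)

lemma H0_const: "Fract [:c:] 1 \<in> H0 (floor_multiple 0 D)"
  by (cases "c = 0") (auto simp: H0_def floor_multiple_def ord_at_const fract_collapse)

lemma H0_uminus: "f \<in> H0 E \<Longrightarrow> - f \<in> H0 E"
  by (cases "f = 0") (auto simp: H0_def ord_at_uminus)

lemma H0_add:
  assumes "f \<in> H0 E" "g \<in> H0 E"
  shows "f + g \<in> H0 E"
proof (cases "f = 0 \<or> g = 0 \<or> f + g = 0")
  case False
  have "ord_at x (f + g) + E x \<ge> 0" if "x \<in> closed_points" for x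
  proof -
    have "ord_at x f + E x \<ge> 0" "ord_at x g + E x \<ge> 0"
      using assms False that by (auto simp: H0_def)
    then show ?thesis using ord_at_add[OF that, of f g] False by linarith
  qed
  then show ?thesis by (simp add: H0_def)
qed (use assms in \<open>auto simp: H0_zero\<close>)

lemma H0_mult:
  assumes "f \<in> H0 (floor_multiple d D)" "g \<in> H0 (floor_multiple e D)"
  shows "f * g \<in> H0 (floor_multiple (d + e) D)"
proof (cases "f = 0 \<or> g = 0")
  case False
  have "ord_at x (f * g) + floor_multiple (d + e) D x \<ge> 0" if "x \<in> closed_points" for x
  proof -
    have "ord_at x f + floor_multiple d D x \<ge> 0" "ord_at x g + floor_multiple e D x \<ge> 0"
      using assms False that by (auto simp: H0_def)
    moreover have "floor_multiple d D x + floor_multiple e D x \<le> floor_multiple (d + e) D x"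
      unfolding floor_multiple_def
      using le_floor_add[of "of_nat d * D x" "of_nat e * D x"] by (simp add: distrib_right)
    ultimately show ?thesis using ord_at_mult[OF that, of f g] False by linarith
  qed
  then show ?thesis by (simp add: H0_def)
qed (auto simp: H0_zero)

lemma H0_sum: "(\<And>i. i \<in> A \<Longrightarrow> f i \<in> H0 E) \<Longrightarrow> sum f A \<in> H0 E"
  by (induction A rule: infinite_finite_induct) (auto intro: H0_zero H0_add)

lemma cring_canonical_ring: "cring (canonical_ring D)"
  unfolding canonical_ring_def
proof (rule cring_ring_on, goal_cases)
  case 2
  have "coeff 1 d \<in> H0 (floor_multiple d D)" for d
    using H0_const[of 1 D] by (cases d) (auto simp: H0_zero pCons_one One_fract_def[symmetric])
  then show ?case by simp
next
  case (4 F G)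
  have "coeff (F * G) d \<in> H0 (floor_multiple d D)" for d
    unfolding coeff_mult
  proof (rule H0_sum)
    fix i assume "i \<in> {..d}"
    then show "coeff F i * coeff G (d - i) \<in> H0 (floor_multiple d D)"
      using H0_mult[of "coeff F i" i D "coeff G (d - i)" "d - i"] 4 by simp
  qed
  then show ?case by simp
qed (auto intro: H0_zero H0_add H0_uminus)

lemma cring_mpoly_ring: "cring (mpoly_ring N)"
  unfolding mpoly_ring_def
proof (rule cring_ring_on, goal_cases)
  case (3 f g)
  then show ?case using keys_add[of f g] by blast
next
  case (4 f g)
  show ?case
  proof safe
    fix m j assume "m \<in> Poly_Mapping.keys (f * g)" "j \<in> Poly_Mapping.keys m"
    then obtain a b where "m = a + b" "a \<in> Poly_Mapping.keys f" "b \<in> Poly_Mapping.keys g"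
      using keys_mult[of f g] by blast
    with \<open>j \<in> Poly_Mapping.keys m\<close> 4 show "j < N" using keys_add[of a b] by blast
  qed
qed auto

end

theory Submission
  imports Defs
begin

text \<open>
  Let \<open>s\<^sub>i\<close> be a linear form vanishing at \<open>P\<^sub>i\<close>.  The degree \<open>d\<close> part of \<open>S\<^sub>D\<close> is spanned by the products
  \<open>\<Prod>s\<^sub>i\<^bsup>c\<^sub>i\<^esup>\<close> with \<open>\<Sum>c\<^sub>i = 0\<close> and all slacks \<open>c\<^sub>i + d\<alpha>\<^sub>i \<ge> 0\<close>, that is, by the lattice points of a simplicial
  cone whose \<open>i\<close>-th primitive edge vector has degree \<open>\<ell>\<^sub>i\<close>, \<open>i\<close>-th slack \<open>\<ell>\<^sub>i deg D\<close> and all other slacks \<open>0\<close>.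
  The slacks sum to \<open>d deg D\<close>, so in degree \<open>d \<ge> \<Sum>\<ell>\<^sub>i\<close> some edge vector can be split off, which gives
  the generators: all lattice points of degree less than \<open>\<Sum>\<ell>\<^sub>i\<close>.  Relations come from monomials with the same
  exponent, where splitting off an edge vector works from degree \<open>2\<Sum>\<ell>\<^sub>i\<close> on, and from
  \<open>s\<^sub>i = b s\<^sub>j + b' s\<^sub>k\<close> times a product with \<open>\<Sum>c\<^sub>i = -1\<close>.  There the slacks sum to \<open>d deg D - 1\<close>, and
  \<open>1 \<le> \<ell> deg D\<close>, so an edge vector splits off from the whole relation once \<open>d \<ge> \<ell> + \<Sum>\<ell>\<^sub>i\<close>.  Splitting off
  writes every relation of large degree in terms of relations of smaller degree.
\<close>


section \<open>Orders of rational functions\<close>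

text \<open>For a rational point this is the linear form vanishing there, with the second
  homogeneous coordinate set to \<open>1\<close>; at infinity the form is that coordinate
  itself.\<close>

definition place_form :: "'k::field poly place \<Rightarrow> 'k poly" where
  "place_form x = (case x of Infinite_Place \<Rightarrow> 1 | Finite_Place p \<Rightarrow> p)"

lemma place_form_nonzero: "x \<in> rational_points \<Longrightarrow> place_form x \<noteq> 0"
  by (auto simp: rational_points_def place_form_def)

text \<open>An irreducible \<open>p\<close> dividing the linear polynomial is associated to it, and
  monic associates are equal. If they are equal, comparing degrees excludes every power above the
  first.\<close>

lemma poly_ord_linear:
  fixes p :: "'k::field poly"
  assumes p: "irreducible p" "lead_coeff p = 1"
  shows "Max {m. p ^ m dvd [:- a, 1:]} = (if p = [:- a, 1:] then 1 else 0)"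
proof -
  let ?q = "[:- a, 1:] :: 'k poly"
  have q: "irreducible ?q" by (rule irreducible_linear_field_poly) simp
  show ?thesis
  proof (cases "p = ?q")
    case True
    have "m \<le> 1" if "p ^ m dvd p" for m
    proof -
      have "degree (p ^ m) \<le> degree p"
        using that True by (intro dvd_imp_degree_le) auto
      moreover have "degree (p ^ m) = m * degree p"
        by (rule degree_power_eq) (use True in simp)
      ultimately show ?thesis using True by simp
    qed
    then have "Max {m. p ^ m dvd p} = 1"
      by (intro Max_eqI) (auto intro: finite_subset[of _ "{..1}"])
    then show ?thesis using True by simp
  next
    case False
    have "\<not> p dvd ?q"
    proof
      assume pq: "p dvd ?q"
      have "\<not> p dvd 1" using p(1) by (auto simp: irreducible_def)
      then have "?q dvd p" using q pq by (meson irreducibleD')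
      obtain r where r: "p = ?q * r" using \<open>?q dvd p\<close> by (elim dvdE)
      have p0: "p \<noteq> 0" "r \<noteq> 0" using p(2) r by auto
      have "degree p \<le> degree ?q" using pq by (intro dvd_imp_degree_le) simp_all
      moreover have "degree p = degree ?q + degree r" unfolding r by (rule degree_mult_eq) (use p0 in auto)
      ultimately have "degree r = 0" by simp
      then obtain c where c: "r = [:c:]" by (rule degree_eq_zeroE)
      have "lead_coeff p = lead_coeff ?q * lead_coeff r" unfolding r by (rule lead_coeff_mult)
      then have "c = 1" using p(2) c by simp
      then have "p = ?q" using r c by simp
      with False show False by simp
    qed
    then have "m = 0" if "p ^ m dvd ?q" for m
      using dvd_trans[OF dvd_power[of m p] that] by (cases m) auto
    then have "{m. p ^ m dvd ?q} = {0}" by auto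
    then show ?thesis using False by simp
  qed
qed

lemma ord_at_one: "x \<in> closed_points \<Longrightarrow> ord_at x 1 = 0"
  using ord_at_const[of x 1] by (simp add: pCons_one One_fract_def)

lemma ord_at_to_fract:
  assumes "x \<in> closed_points" "a \<noteq> 0"
  shows "ord_at x (to_fract a) = poly_ord x a"
proof -
  have "poly_ord x 1 + poly_ord x 1 = poly_ord x 1"
    using poly_ord_mult[OF assms(1), of 1 1] by simp
  then show ?thesis
    using assms by (simp add: to_fract_def ord_at_Fract)
qed

text \<open>The divisor of a dehomogenised linear form is its zero minus infinity; for the form
  \<open>1\<close> of the point at infinity the two terms cancel.\<close>

lemma ord_at_place_form:
  assumes "x \<in> closed_points" "y \<in> rational_points"
  shows "ord_at x (to_fract (place_form y)) = of_bool (x = y) - of_bool (x = Infinite_Place)"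
proof (cases y)
  case Infinite_Place
  then show ?thesis using assms(1) by (simp add: place_form_def ord_at_one)
next
  case (Finite_Place q)
  then obtain a where "q = [:- a, 1:]" using assms(2) by (auto simp: rational_points_def)
  then show ?thesis
    using assms Finite_Place
    by (cases x) (auto simp: ord_at_to_fract place_form_def closed_points_def poly_ord_linear)
qed

lemma ord_at_power:
  assumes "x \<in> closed_points" "f \<noteq> 0"
  shows "ord_at x (f ^ m) = int m * ord_at x f"
  by (induction m) (use assms in \<open>simp_all add: ord_at_one ord_at_mult algebra_simps\<close>)

lemma ord_at_inverse:
  assumes "x \<in> closed_points" "f \<noteq> 0"
  shows "ord_at x (inverse f) = - ord_at x f"
  using ord_at_mult[OF assms(1), of f "inverse f"] assms ord_at_one[OF assms(1)] by simp

lemma ord_at_power_int: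
  assumes "x \<in> closed_points" "f \<noteq> 0"
  shows "ord_at x (f powi m) = m * ord_at x f"
  using assms by (simp add: power_int_def ord_at_power ord_at_inverse)

lemma ord_at_prod:
  assumes "x \<in> closed_points" "\<And>i. i \<in> A \<Longrightarrow> f i \<noteq> 0"
  shows "ord_at x (\<Prod>i\<in>A. f i) = (\<Sum>i\<in>A. ord_at x (f i))"
  using assms(2)
  by (induction A rule: infinite_finite_induct) (use assms(1) in \<open>simp_all add: ord_at_one ord_at_mult\<close>)

section \<open>Rational functions without finite poles, and binary forms\<close>

lemma monic_irreducible_factor:
  fixes b :: "'k::field poly"
  assumes "degree b > 0"
  shows "\<exists>p. irreducible p \<and> lead_coeff p = 1 \<and> p dvd b"
proof -
  \<comment> \<open>A non-constant divisor of least degree is irreducible, since a proper factor of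
    it would be a smaller one.\<close>
  define p where "p = arg_min degree (\<lambda>p. degree p > 0 \<and> p dvd b)"
  have p: "degree p > 0" "p dvd b"
    using arg_min_natI[of "\<lambda>p. degree p > 0 \<and> p dvd b" b degree] assms by (auto simp: p_def)
  have least: "degree p \<le> degree r" if "degree r > 0" "r dvd b" for r
    unfolding p_def by (rule arg_min_nat_le) (use that in simp)
  have p0: "p \<noteq> 0" using p by auto
  have irr: "irreducible p"
  proof (rule irreducibleI)
    show "\<not> p dvd 1" using p p0 by (simp add: is_unit_iff_degree)
    fix c d assume cd: "p = c * d"
    then have c0: "c \<noteq> 0" "d \<noteq> 0" using p0 by auto
    show "c dvd 1 \<or> d dvd 1"
    proof (rule ccontr)
      assume "\<not> (c dvd 1 \<or> d dvd 1)"
      then have "degree c > 0" "degree d > 0" using c0 by (auto simp: is_unit_iff_degree)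
      moreover have "degree p = degree c + degree d" using cd c0 by (simp add: degree_mult_eq)
      moreover have "c dvd b" using cd p(2) by (metis dvd_mult_left)
      ultimately show False using least[of c] by simp
    qed
  qed (use p0 in simp)
  let ?c = "inverse (lead_coeff p)"
  have c: "?c \<noteq> 0" using p0 by simp
  have u: "is_unit [:?c:]" using c by (simp add: is_unit_iff_degree)
  have "smult ?c p = [:?c:] * p" by simp
  moreover have "irreducible ([:?c:] * p)"
    using irr u by (simp only: irreducible_mult_unit_left)
  ultimately have "irreducible (smult ?c p)" by simp
  moreover have "lead_coeff (smult ?c p) = 1" using p0 by simp
  moreover have "smult ?c p dvd b" using c p(2) by (simp add: smult_dvd)
  ultimately show ?thesis by blast
qed

text \<open>Choose the denominator of least degree. Nonnegative order at an irreducible factor of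
  the denominator forces that factor to divide the numerator as well, so it could be cancelled;
  hence the denominator is constant.\<close>

lemma fract_integral:
  fixes f :: "'k::field poly fract"
  assumes f: "f \<noteq> 0"
    and ord: "\<And>p. Finite_Place p \<in> closed_points \<Longrightarrow> ord_at (Finite_Place p) f \<ge> 0"
  shows "\<exists>g. g \<noteq> 0 \<and> f = to_fract g"
proof -
  let ?Q = "\<lambda>b. b \<noteq> 0 \<and> (\<exists>a. a \<noteq> 0 \<and> f = Fract a b)"
  define b where "b = arg_min degree ?Q"
  obtain a0 b0 where "a0 \<noteq> 0" "b0 \<noteq> 0" "f = Fract a0 b0" using f by (rule fract_nonzeroE)
  then have "?Q b0" by blast
  then have b: "?Q b" unfolding b_def by (rule arg_min_natI)
  then obtain a where a: "a \<noteq> 0" "f = Fract a b" by blast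
  have least: "degree b \<le> degree b'" if "?Q b'" for b'
    unfolding b_def by (rule arg_min_nat_le) (use that in simp)
  have "degree b = 0"
  proof (rule ccontr)
    assume "degree b \<noteq> 0"
    then obtain p where p: "irreducible p" "lead_coeff p = 1" "p dvd b"
      using monic_irreducible_factor[of b] by auto
    then have cp: "Finite_Place p \<in> closed_points" by (auto simp: closed_points_def)
    obtain b' where b': "b = p * b'" using p(3) by (elim dvdE)
    have "ord_at (Finite_Place p) f = int (Max {n. p ^ n dvd a}) - int (Max {n. p ^ n dvd b})"
      using ord_at_Fract[OF cp, of a b] a b by simp
    moreover have "1 \<le> Max {n. p ^ n dvd b}"
      using dvd_power_le_Max[of p b 1] p b by simp
    ultimately have "1 \<le> Max {n. p ^ n dvd a}" using ord[OF cp] by linarith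
    then have "p ^ 1 dvd a"
      using Max_dvd_power[OF p(1) a(1)] by (meson dvd_trans le_imp_power_dvd)
    then obtain a' where a': "a = p * a'" by (auto elim: dvdE)
    have nz: "p \<noteq> 0" "a' \<noteq> 0" "b' \<noteq> 0" using a(1) b a' b' by auto
    have "f = Fract a' b'" using a(2) nz by (simp add: a' b' eq_fract)
    then have "degree b \<le> degree b'" using nz by (intro least) blast
    moreover have "degree b = degree p + degree b'" using nz by (simp add: b' degree_mult_eq)
    moreover have "degree p > 0" using p(1) by (auto simp: irreducible_def is_unit_iff_degree)
    ultimately show False by simp
  qed
  then obtain c where c: "b = [:c:]" by (rule degree_eq_zeroE)
  with b have "c \<noteq> 0" by simp
  have "f = to_fract (smult (inverse c) a)"
    using a(2) \<open>c \<noteq> 0\<close> by (simp add: to_fract_def c eq_fract)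
  then show ?thesis using a(1) \<open>c \<noteq> 0\<close> by (metis inverse_nonzero_iff_nonzero smult_eq_0_iff)
qed

text \<open>These products are dehomogenised binary forms of degree \<open>m\<close> in two
  independent linear forms; \<open>t = 1\<close> is the expansion around \<open>a\<close>. The value
  at \<open>a\<close> determines the coefficient of \<open>t ^ m\<close>, and subtracting that term
  leaves a multiple of \<open>[:- a, 1:]\<close>, whose cofactor is treated by induction.\<close>

lemma poly_binary_form:
  fixes g t :: "'k::field poly"
  assumes t: "poly t a \<noteq> 0" "degree t \<le> 1" and g: "degree g \<le> m"
  shows "\<exists>c. g = (\<Sum>k\<le>m. smult (c k) ([:- a, 1:] ^ k * t ^ (m - k)))"
  using g
proof (induction m arbitrary: g)
  case 0
  then have "g = [:coeff g 0:]" by (simp add: degree_0_id)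
  then show ?case by (intro exI[of _ "\<lambda>_. coeff g 0"]) simp
next
  case (Suc m)
  define c0 where "c0 = poly g a / poly t a ^ Suc m"
  have "poly (g - smult c0 (t ^ Suc m)) a = 0"
    using t(1) by (simp add: c0_def poly_power del: power_Suc)
  then obtain h where h: "g - smult c0 (t ^ Suc m) = [:- a, 1:] * h"
    unfolding poly_eq_0_iff_dvd by (elim dvdE)
  have "degree h \<le> m"
  proof (cases "h = 0")
    case False
    have "degree (t ^ Suc m) \<le> Suc m"
      using order.trans[OF degree_power_le mult_le_mono1[OF t(2)], of "Suc m"] by simp
    then have "degree (g - smult c0 (t ^ Suc m)) \<le> Suc m"
      using Suc.prems by (intro degree_diff_le) (auto intro: order.trans[OF degree_smult_le])
    then have "degree ([:- a, 1:] * h) \<le> Suc m" by (simp only: h)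
    then show ?thesis using False by (subst (asm) degree_mult_eq) auto
  qed simp
  from Suc.IH[OF this] obtain c where c: "h = (\<Sum>k\<le>m. smult (c k) ([:- a, 1:] ^ k * t ^ (m - k)))" by blast
  have "g = smult c0 (t ^ Suc m) + [:- a, 1:] * h" unfolding h[symmetric] by simp
  also have "\<dots> = (\<Sum>k\<le>Suc m. smult (case k of 0 \<Rightarrow> c0 | Suc j \<Rightarrow> c j) ([:- a, 1:] ^ k * t ^ (Suc m - k)))"
    unfolding c sum.atMost_Suc_shift sum_distrib_left
    by (simp add: mult.assoc del: mult_pCons_left)
  finally show ?case by blast
qed

text \<open>Evaluation at \<open>a\<close> isolates the coefficient with \<open>k = 0\<close>;
  cancelling one factor \<open>[:- a, 1:]\<close> then lowers \<open>m\<close>.\<close>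

lemma binary_form_zero:
  fixes t :: "'k::field poly"
  assumes t: "poly t a \<noteq> 0"
    and "(\<Sum>k\<le>m. smult (c k) ([:- a, 1:] ^ k * t ^ (m - k))) = 0" and "k \<le> m"
  shows "c k = 0"
  using assms(2,3)
proof (induction m arbitrary: c k)
  case (Suc m)
  define h where "h = (\<Sum>k\<le>m. smult (c (Suc k)) ([:- a, 1:] ^ k * t ^ (m - k)))"
  have eq: "smult (c 0) (t ^ Suc m) + [:- a, 1:] * h = 0"
    using Suc.prems(1) unfolding sum.atMost_Suc_shift h_def sum_distrib_left
    by (simp add: mult.assoc del: mult_pCons_left)
  then have "poly (smult (c 0) (t ^ Suc m) + [:- a, 1:] * h) a = 0" by simp
  then have c0: "c 0 = 0" using t by (simp add: poly_power)
  then have "[:- a, 1:] * h = 0" using eq by simp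
  then have "h = 0" unfolding mult_eq_0_iff by simp
  then have "c (Suc j) = 0" if "j \<le> m" for j
    using Suc.IH[of "\<lambda>k. c (Suc k)" j] that unfolding h_def by blast
  then show ?case using c0 Suc.prems(2) by (cases k) auto
qed simp


section \<open>Products of linear forms\<close>

abbreviation fconst :: "'k::field \<Rightarrow> 'k poly fract" where
  "fconst c \<equiv> to_fract [:c:]"

lemma fconst_add: "fconst (a + b) = fconst a + fconst b"
  by (simp flip: to_fract_add)

lemma fconst_mult: "fconst (a * b) = fconst a * fconst b"
  by (simp flip: to_fract_mult)

lemma fconst_one: "fconst 1 = 1"
  by (simp add: pCons_one)

lemma to_fract_sum: "to_fract (\<Sum>i\<in>A. f i) = (\<Sum>i\<in>A. to_fract (f i))"
  by (induction A rule: infinite_finite_induct) simp_all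

lemma to_fract_power: "to_fract (f ^ m) = to_fract f ^ m"
  by (induction m) simp_all

lemma to_fract_smult: "to_fract (smult c f) = fconst c * to_fract f"
  by (simp flip: to_fract_mult)

lemma H0_const_mult:
  assumes "f \<in> H0 E"
  shows "fconst c * f \<in> H0 E"
proof (cases "c = 0 \<or> f = 0")
  case False
  then show ?thesis
    using assms by (auto simp: H0_def ord_at_mult to_fract_def ord_at_const[unfolded to_fract_def])
qed (auto simp: H0_zero)

text \<open>The indices \<open>i\<^sub>0\<close> and \<open>j\<^sub>0\<close> single out two points
  whose forms serve as homogeneous coordinates. The first point is finite, so that its form has a
  root at which the other form can be evaluated.\<close>

locale rational_divisor =
  fixes n :: nat and P :: "nat \<Rightarrow> 'k::field poly place" and \<alpha> :: "nat \<Rightarrow> rat" and i\<^sub>0 j\<^sub>0 :: nat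
  assumes inj_P: "inj_on P {1..n}"
    and rational_P: "i \<in> {1..n} \<Longrightarrow> P i \<in> rational_points"
    and i0: "i\<^sub>0 \<in> {1..n}" "P i\<^sub>0 \<noteq> Infinite_Place"
    and j0: "j\<^sub>0 \<in> {1..n}" "j\<^sub>0 \<noteq> i\<^sub>0"
begin

definition s :: "nat \<Rightarrow> 'k poly fract" where
  "s i = to_fract (place_form (P i))"

definition z :: "(nat \<Rightarrow> int) \<Rightarrow> 'k poly fract" where
  "z c = (\<Prod>i=1..n. s i powi c i)"

text \<open>
  The linear forms \<^term>\<open>s i\<close> are dehomogenised, so \<^term>\<open>z c\<close> has the divisor \<open>\<Sum>i. c i P\<^sub>i\<close> only if
  \<open>c\<close> has sum \<open>0\<close>.  The exponents with sum \<open>-1\<close> index the linear relations between the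
  \<^term>\<open>s i\<close>.
\<close>

definition cone :: "nat \<Rightarrow> nat \<Rightarrow> (nat \<Rightarrow> int) set" where
  "cone t d = {c. (\<forall>i. i \<notin> {1..n} \<longrightarrow> c i = 0) \<and> (\<Sum>i=1..n. c i) = - int t \<and>
    (\<forall>i\<in>{1..n}. of_int (c i) + of_nat d * \<alpha> i \<ge> 0)}"

abbreviation D :: "'k poly place \<Rightarrow> rat" where
  "D \<equiv> point_divisor n P \<alpha>"

definition flr :: "nat \<Rightarrow> nat \<Rightarrow> int" where
  "flr d i = \<lfloor>of_nat d * \<alpha> i\<rfloor>"

definition deg_floor :: "nat \<Rightarrow> int" where
  "deg_floor d = (\<Sum>i=1..n. flr d i)"

text \<open>All floored slacks outside \<open>i\<^sub>0\<close> and \<open>j\<^sub>0\<close> are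
  zero, and these two share \<open>deg_floor d\<close>. The exponents with
  \<open>0 \<le> k \<le> deg_floor d\<close> index a basis of the degree \<open>d\<close>
  part.\<close>

definition normal :: "nat \<Rightarrow> nat \<Rightarrow> nat \<Rightarrow> int" where
  "normal d k = (\<lambda>i. (if i \<in> {1..n} then - flr d i else 0) + (if i = i\<^sub>0 then int k else 0)
    + (if i = j\<^sub>0 then deg_floor d - int k else 0))"

section \<open>Divisors of products of linear forms\<close>

lemma s_nonzero: "i \<in> {1..n} \<Longrightarrow> s i \<noteq> 0"
  using place_form_nonzero[OF rational_P] by (simp add: s_def)

lemma z_nonzero: "z c \<noteq> 0"
  by (auto simp: z_def s_nonzero)

lemma z_add: "z (\<lambda>i. c i + c' i) = z c * z c'"
  unfolding z_def prod.distrib[symmetric] by (intro prod.cong) (simp_all add: power_int_add s_nonzero)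

lemma z_zero: "z (\<lambda>i. 0) = 1"
  by (simp add: z_def)

lemma z_single:
  assumes "a \<in> {1..n}"
  shows "z (\<lambda>i. if i = a then m else 0) = s a powi m"
proof -
  have "z (\<lambda>i. if i = a then m else 0) = (\<Prod>i\<in>{1..n}. if i = a then s a powi m else 1)"
    unfolding z_def by (intro prod.cong) auto
  then show ?thesis using assms by simp
qed

text \<open>Each factor contributes its point minus infinity, so the total exponent is subtracted at
  infinity.\<close>

lemma ord_at_z:
  assumes "x \<in> closed_points"
  shows "ord_at x (z c) = (\<Sum>i\<in>{i\<in>{1..n}. P i = x}. c i) - (if x = Infinite_Place then \<Sum>i=1..n. c i else 0)"
proof -
  have "ord_at x (s i) = of_bool (x = P i) - of_bool (x = Infinite_Place)" if "i \<in> {1..n}" for i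
    unfolding s_def by (rule ord_at_place_form[OF assms rational_P[OF that]])
  note ord_s = this
  have "ord_at x (z c) = (\<Sum>i=1..n. ord_at x (s i powi c i))"
    unfolding z_def by (rule ord_at_prod[OF assms]) (simp add: s_nonzero)
  also have "\<dots> = (\<Sum>i=1..n. c i * (of_bool (x = P i) - of_bool (x = Infinite_Place)))"
    by (intro sum.cong) (simp_all only: ord_at_power_int[OF assms s_nonzero] ord_s)
  also have "\<dots> = (\<Sum>i=1..n. if P i = x then c i else 0) - (\<Sum>i=1..n. if x = Infinite_Place then c i else 0)"
    unfolding sum_subtractf[symmetric] by (intro sum.cong) auto
  also have "(\<Sum>i=1..n. if P i = x then c i else 0) = (\<Sum>i\<in>{i\<in>{1..n}. P i = x}. c i)"
    by (rule sum.inter_filter[symmetric]) simp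
  finally show ?thesis by simp
qed

text \<open>At most one \<open>P i\<close> equals \<open>x\<close>, so the floor commutes with the
  sum.\<close>

lemma floor_multiple_D: "floor_multiple d D x = (\<Sum>i\<in>{i\<in>{1..n}. P i = x}. flr d i)"
proof (cases "\<exists>i\<in>{1..n}. P i = x")
  case True
  then obtain i where "i \<in> {1..n}" "P i = x" by blast
  then have "{i\<in>{1..n}. P i = x} = {i}" using inj_onD[OF inj_P] by blast
  then show ?thesis by (simp add: floor_multiple_def point_divisor_def flr_def)
next
  case False
  then have e: "{i\<in>{1..n}. P i = x} = {}" by blast
  then show ?thesis unfolding floor_multiple_def point_divisor_def e by simp
qed

lemma slack_iff: "of_int (c i) + of_nat d * \<alpha> i \<ge> 0 \<longleftrightarrow> c i + flr d i \<ge> 0"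
  unfolding flr_def by linarith

text \<open>The correction at infinity vanishes for exponents with sum \<open>0\<close>, and what
  remains of the condition is that sums of floored slacks are nonnegative.\<close>

lemma z_in_H0:
  assumes "c \<in> cone 0 d"
  shows "z c \<in> H0 (floor_multiple d D)"
proof -
  have "0 \<le> (\<Sum>i\<in>{i\<in>{1..n}. P i = x}. c i + flr d i)" for x
    using assms by (intro sum_nonneg) (auto simp: cone_def slack_iff)
  then show ?thesis
    using assms unfolding H0_def
    by (auto simp: ord_at_z floor_multiple_D cone_def sum.distrib)
qed

lemma normal_cone:
  assumes "int k \<le> deg_floor d"
  shows "normal d k \<in> cone 0 d"
proof -
  have "(\<Sum>i=1..n. normal d k i) = - deg_floor d + int k + (deg_floor d - int k)"
    unfolding normal_def sum.distrib using i0(1) j0(1)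
    by (simp add: deg_floor_def sum_negf del: atLeastAtMost_iff)
  moreover have "normal d k i + flr d i \<ge> 0" if "i \<in> {1..n}" for i
    using that assms by (simp add: normal_def)
  ultimately show ?thesis
    using i0(1) j0(1) unfolding cone_def slack_iff by (auto simp: normal_def)
qed

section \<open>Bases of the graded pieces\<close>

lemma i0_form:
  obtains a where "place_form (P i\<^sub>0) = [:- a, 1:]" "poly (place_form (P j\<^sub>0)) a \<noteq> 0"
proof -
  obtain a where a: "P i\<^sub>0 = Finite_Place [:- a, 1:]"
    using rational_P[OF i0(1)] i0(2) by (auto simp: rational_points_def)
  have ne: "P j\<^sub>0 \<noteq> P i\<^sub>0" using inj_onD[OF inj_P _ j0(1) i0(1)] j0(2) by blast
  have "poly (place_form (P j\<^sub>0)) a \<noteq> 0"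
    using rational_P[OF j0(1)] a ne by (auto simp: rational_points_def place_form_def)
  then show ?thesis using a that by (simp add: place_form_def)
qed

lemma degree_place_form: "i \<in> {1..n} \<Longrightarrow> degree (place_form (P i)) \<le> 1"
  using rational_P[of i] by (auto simp: rational_points_def place_form_def)

lemma z_normal:
  assumes "k \<le> m" "deg_floor d = int m"
  shows "z (normal d k) =
    z (\<lambda>i. if i \<in> {1..n} then - flr d i else 0) * to_fract (place_form (P i\<^sub>0) ^ k * place_form (P j\<^sub>0) ^ (m - k))"
proof -
  have "deg_floor d - int k = int (m - k)" using assms by simp
  then show ?thesis
    unfolding normal_def using i0(1) j0(1)
    by (simp add: z_add z_single to_fract_power s_def mult.assoc del: atLeastAtMost_iff)
qed

text \<open>Multiplication by the product of the \<open>s i powi flr d i\<close> clears the finite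
  poles and leaves a polynomial of degree at most \<open>deg_floor d\<close>, which expands as a
  binary form in the two coordinates. For negative \<open>deg_floor d\<close> only
  \<open>f = 0\<close> is possible and the sum is empty.\<close>

lemma H0_span:
  assumes f: "f \<in> H0 (floor_multiple d D)"
  shows "\<exists>c. f = (\<Sum>k<nat (deg_floor d + 1). fconst (c k) * z (normal d k))"
proof (cases "f = 0")
  case True
  then show ?thesis by (intro exI[of _ "\<lambda>_. 0"]) simp
next
  case False
  define G where "G = z (\<lambda>i. if i \<in> {1..n} then flr d i else 0)"
  define G' where "G' = z (\<lambda>i. if i \<in> {1..n} then - flr d i else 0)"
  have GG': "G' * G = 1"
  proof -
    have "G' * G = z (\<lambda>i. (if i \<in> {1..n} then - flr d i else 0) + (if i \<in> {1..n} then flr d i else 0))"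
      unfolding G_def G'_def by (rule z_add[symmetric])
    also have "\<dots> = z (\<lambda>i. 0)" by (rule arg_cong[of _ _ z]) auto
    finally show ?thesis by (simp only: z_zero)
  qed
  have G0: "G \<noteq> 0" unfolding G_def by (rule z_nonzero)
  have ordG: "ord_at x G = floor_multiple d D x - (if x = Infinite_Place then deg_floor d else 0)"
    if "x \<in> closed_points" for x
    unfolding G_def ord_at_z[OF that] floor_multiple_D deg_floor_def by simp
  have ord: "ord_at x (f * G) \<ge> (if x = Infinite_Place then - deg_floor d else 0)"
    if "x \<in> closed_points" for x
  proof -
    have "ord_at x f + floor_multiple d D x \<ge> 0" using f False that unfolding H0_def by blast
    then show ?thesis unfolding ord_at_mult[OF that False G0] ordG[OF that]
      by (cases "x = Infinite_Place") simp_all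
  qed
  have "f * G \<noteq> 0" using False G0 by (metis mult_eq_0_iff)
  then obtain g where g: "g \<noteq> 0" "f * G = to_fract g"
  proof -
    have "ord_at (Finite_Place p) (f * G) \<ge> 0" if "Finite_Place p \<in> closed_points" for p
      using ord[OF that] by simp
    then show ?thesis using fract_integral[OF \<open>f * G \<noteq> 0\<close>] that by blast
  qed
  have inf: "Infinite_Place \<in> (closed_points :: 'k poly place set)" by (simp add: closed_points_def)
  \<comment> \<open>The order of a polynomial at infinity is minus its degree, so the bound there
    limits the degree of \<open>g\<close> and also shows that \<open>deg_floor d\<close> is
    nonnegative.\<close>
  have "int (degree g) \<le> deg_floor d"
    using ord[OF inf] by (simp add: g(2) ord_at_to_fract[OF inf g(1)])
  then obtain m where m: "deg_floor d = int m" "degree g \<le> m"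
    by (intro that[of "nat (deg_floor d)"]) linarith+
  obtain a where a: "place_form (P i\<^sub>0) = [:- a, 1:]" "poly (place_form (P j\<^sub>0)) a \<noteq> 0" by (rule i0_form)
  obtain c where c: "g = (\<Sum>k\<le>m. smult (c k) ([:- a, 1:] ^ k * place_form (P j\<^sub>0) ^ (m - k)))"
    using poly_binary_form[OF a(2) degree_place_form[OF j0(1)] m(2)] by blast
  have "f = f * (G' * G)" using GG' by simp
  also have "\<dots> = G' * to_fract g" by (simp add: g(2)[symmetric] ac_simps)
  also have "\<dots> = (\<Sum>k\<le>m. fconst (c k) * z (normal d k))"
    unfolding c to_fract_sum sum_distrib_left
  proof (intro sum.cong refl)
    fix k assume "k \<in> {..m}"
    then have "k \<le> m" by simp
    from z_normal[OF this m(1)]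
    show "G' * to_fract (smult (c k) ([:- a, 1:] ^ k * place_form (P j\<^sub>0) ^ (m - k))) = fconst (c k) * z (normal d k)"
      by (simp only: a(1) to_fract_smult G'_def mult.left_commute)
  qed
  also have "{..m} = {..<nat (deg_floor d + 1)}" using m(1) by auto
  finally show ?thesis by blast
qed

text \<open>Once the common nonzero factor is removed, this is the independence of the binary
  forms.\<close>

lemma normal_independent:
  assumes "(\<Sum>k<nat (deg_floor d + 1). fconst (c k) * z (normal d k)) = 0" "k < nat (deg_floor d + 1)"
  shows "c k = 0"
proof -
  obtain m where m: "deg_floor d = int m" using assms(2) by (intro that[of "nat (deg_floor d)"]) linarith
  obtain a where a: "place_form (P i\<^sub>0) = [:- a, 1:]" "poly (place_form (P j\<^sub>0)) a \<noteq> 0" by (rule i0_form)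
  let ?g = "(\<Sum>k\<le>m. smult (c k) ([:- a, 1:] ^ k * place_form (P j\<^sub>0) ^ (m - k)))"
  let ?G = "z (\<lambda>i. if i \<in> {1..n} then - flr d i else 0)"
  have "{..m} = {..<nat (deg_floor d + 1)}" using m by auto
  then have "0 = (\<Sum>k\<le>m. fconst (c k) * z (normal d k))" using assms(1) by simp
  also have "\<dots> = ?G * to_fract ?g"
    unfolding to_fract_sum sum_distrib_left
  proof (intro sum.cong refl)
    fix k assume "k \<in> {..m}"
    then have "k \<le> m" by simp
    from z_normal[OF this m]
    show "fconst (c k) * z (normal d k) = ?G * to_fract (smult (c k) ([:- a, 1:] ^ k * place_form (P j\<^sub>0) ^ (m - k)))"
      by (simp only: a(1) to_fract_smult mult.left_commute)
  qed
  finally have "?G * to_fract ?g = 0" ..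
  then have "to_fract ?g = 0" using z_nonzero unfolding mult_eq_0_iff by blast
  then have "?g = 0" by (rule to_fract_eq_0_iff[THEN iffD1])
  then show ?thesis
    by (rule binary_form_zero[OF a(2)]) (use assms(2) m in linarith)
qed

text \<open>The binary form expansion in degree \<open>1\<close>: two linear forms with distinct
  zeros span all of them.\<close>

lemma s_linear:
  assumes "i \<in> {1..n}"
  shows "\<exists>b b'. s i = fconst b * s i\<^sub>0 + fconst b' * s j\<^sub>0"
proof -
  obtain a where a: "place_form (P i\<^sub>0) = [:- a, 1:]" "poly (place_form (P j\<^sub>0)) a \<noteq> 0" by (rule i0_form)
  obtain c where "place_form (P i) = (\<Sum>k\<le>1. smult (c k) ([:- a, 1:] ^ k * place_form (P j\<^sub>0) ^ (1 - k)))"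
    using poly_binary_form[OF a(2) degree_place_form[OF j0(1)] degree_place_form[OF assms]] by blast
  then have "place_form (P i) = smult (c 1) (place_form (P i\<^sub>0)) + smult (c 0) (place_form (P j\<^sub>0))"
    by (simp add: a(1) del: smult_pCons)
  then have "s i = fconst (c 1) * s i\<^sub>0 + fconst (c 0) * s j\<^sub>0"
    by (simp only: s_def to_fract_add to_fract_smult)
  then show ?thesis by blast
qed

end


section \<open>Weighted polynomial rings\<close>

definition monomial_eval :: "(nat \<Rightarrow> 'b::comm_ring_1) \<Rightarrow> (nat \<Rightarrow>\<^sub>0 nat) \<Rightarrow> 'b" where
  "monomial_eval g m = (\<Prod>j\<in>Poly_Mapping.keys m. g j ^ Poly_Mapping.lookup m j)"

definition mpoly_eval :: "('k::field \<Rightarrow> 'b::comm_ring_1) \<Rightarrow> (nat \<Rightarrow> 'b) \<Rightarrow> 'k mpoly \<Rightarrow> 'b" where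
  "mpoly_eval \<kappa> g f = (\<Sum>m\<in>Poly_Mapping.keys f. \<kappa> (Poly_Mapping.lookup f m) * monomial_eval g m)"

definition weight :: "(nat \<Rightarrow> nat) \<Rightarrow> (nat \<Rightarrow>\<^sub>0 nat) \<Rightarrow> nat" where
  "weight w m = (\<Sum>j\<in>Poly_Mapping.keys m. Poly_Mapping.lookup m j * w j)"

text \<open>Admitting zero exponents lets several monomials be treated over one common index
  set.\<close>

lemma monomial_eval_superset:
  assumes "finite A" "Poly_Mapping.keys m \<subseteq> A"
  shows "monomial_eval g m = (\<Prod>j\<in>A. g j ^ Poly_Mapping.lookup m j)"
  unfolding monomial_eval_def
  by (rule prod.mono_neutral_left) (use assms in \<open>auto simp: in_keys_iff\<close>)

lemma weight_superset:
  assumes "finite A" "Poly_Mapping.keys m \<subseteq> A"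
  shows "weight w m = (\<Sum>j\<in>A. Poly_Mapping.lookup m j * w j)"
  unfolding weight_def
  by (rule sum.mono_neutral_left) (use assms in \<open>auto simp: in_keys_iff\<close>)

lemma monomial_eval_zero [simp]: "monomial_eval g 0 = 1"
  by (simp add: monomial_eval_def)

lemma weight_zero [simp]: "weight w 0 = 0"
  by (simp add: weight_def)

lemma monomial_eval_single [simp]: "monomial_eval g (Poly_Mapping.single j k) = g j ^ k"
  by (subst monomial_eval_superset[of "{j}"]) auto

lemma weight_single [simp]: "weight w (Poly_Mapping.single j k) = k * w j"
  by (subst weight_superset[of "{j}"]) auto

lemma monomial_eval_add: "monomial_eval g (m + m') = monomial_eval g m * monomial_eval g m'"
proof -
  let ?A = "Poly_Mapping.keys m \<union> Poly_Mapping.keys m'"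
  have A: "finite ?A" "Poly_Mapping.keys (m + m') \<subseteq> ?A" "Poly_Mapping.keys m \<subseteq> ?A"
    "Poly_Mapping.keys m' \<subseteq> ?A" using keys_add[of m m'] by auto
  show ?thesis
    by (simp only: monomial_eval_superset[OF A(1,2)] monomial_eval_superset[OF A(1,3)]
        monomial_eval_superset[OF A(1,4)] lookup_add power_add prod.distrib)
qed

lemma weight_add: "weight w (m + m') = weight w m + weight w m'"
proof -
  let ?A = "Poly_Mapping.keys m \<union> Poly_Mapping.keys m'"
  have A: "finite ?A" "Poly_Mapping.keys (m + m') \<subseteq> ?A" "Poly_Mapping.keys m \<subseteq> ?A"
    "Poly_Mapping.keys m' \<subseteq> ?A" using keys_add[of m m'] by auto
  show ?thesis
    by (simp only: weight_superset[OF A(1,2)] weight_superset[OF A(1,3)]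
        weight_superset[OF A(1,4)] lookup_add distrib_right sum.distrib)
qed

lemma poly_mapping_sum_single:
  fixes f :: "'a \<Rightarrow>\<^sub>0 'b::comm_monoid_add"
  shows "f = (\<Sum>m\<in>Poly_Mapping.keys f. Poly_Mapping.single m (Poly_Mapping.lookup f m))"
proof (rule poly_mapping_eqI)
  fix m
  have "Poly_Mapping.lookup (\<Sum>m\<in>Poly_Mapping.keys f. Poly_Mapping.single m (Poly_Mapping.lookup f m)) m =
    (\<Sum>m'\<in>Poly_Mapping.keys f. if m' = m then Poly_Mapping.lookup f m' else 0)"
    unfolding lookup_sum by (intro sum.cong) (auto simp: lookup_single when_def)
  also have "\<dots> = Poly_Mapping.lookup f m"
    by (simp add: in_keys_iff)
  finally show "Poly_Mapping.lookup f m =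
    Poly_Mapping.lookup (\<Sum>m\<in>Poly_Mapping.keys f. Poly_Mapping.single m (Poly_Mapping.lookup f m)) m" ..
qed

lemma single_conv_const_mult: "Poly_Mapping.single m c = mpoly_const c * Poly_Mapping.single m 1"
  by (simp add: mpoly_const_def mult_single)

section \<open>Evaluation as a ring homomorphism\<close>

locale eval_hom =
  fixes \<kappa> :: "'k::field \<Rightarrow> 'b::comm_ring_1" and g :: "nat \<Rightarrow> 'b"
  assumes \<kappa>_add: "\<kappa> (a + b) = \<kappa> a + \<kappa> b"
    and \<kappa>_mult: "\<kappa> (a * b) = \<kappa> a * \<kappa> b"
    and \<kappa>_one: "\<kappa> 1 = 1"
begin

lemma \<kappa>_zero: "\<kappa> 0 = 0"
  using \<kappa>_add[of 0 0] by simp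

lemma eval_superset:
  assumes "finite A" "Poly_Mapping.keys f \<subseteq> A"
  shows "mpoly_eval \<kappa> g f = (\<Sum>m\<in>A. \<kappa> (Poly_Mapping.lookup f m) * monomial_eval g m)"
  unfolding mpoly_eval_def
  by (rule sum.mono_neutral_left) (use assms in \<open>auto simp: in_keys_iff \<kappa>_zero\<close>)

lemma eval_single: "mpoly_eval \<kappa> g (Poly_Mapping.single m c) = \<kappa> c * monomial_eval g m"
  by (subst eval_superset[of "{m}"]) auto

lemma eval_const: "mpoly_eval \<kappa> g (mpoly_const c) = \<kappa> c"
  by (simp add: mpoly_const_def eval_single)

lemma eval_zero: "mpoly_eval \<kappa> g 0 = 0"
  by (simp add: mpoly_eval_def)

lemma eval_one: "mpoly_eval \<kappa> g 1 = 1"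
  using eval_single[of 0 1] by (simp add: \<kappa>_one)

lemma eval_add: "mpoly_eval \<kappa> g (f + f') = mpoly_eval \<kappa> g f + mpoly_eval \<kappa> g f'"
proof -
  let ?A = "Poly_Mapping.keys f \<union> Poly_Mapping.keys f'"
  have A: "finite ?A" "Poly_Mapping.keys (f + f') \<subseteq> ?A" "Poly_Mapping.keys f \<subseteq> ?A"
    "Poly_Mapping.keys f' \<subseteq> ?A" using keys_add[of f f'] by auto
  show ?thesis
    by (simp only: eval_superset[OF A(1,2)] eval_superset[OF A(1,3)] eval_superset[OF A(1,4)]
        lookup_add \<kappa>_add distrib_right sum.distrib)
qed

lemma eval_uminus: "mpoly_eval \<kappa> g (- f) = - mpoly_eval \<kappa> g f"
  using eval_add[of f "- f"] by (simp add: eval_zero eq_neg_iff_add_eq_0 add.commute)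

lemma eval_diff: "mpoly_eval \<kappa> g (f - f') = mpoly_eval \<kappa> g f - mpoly_eval \<kappa> g f'"
  using eval_add[of f "- f'"] by (simp add: eval_uminus)

lemma eval_sum: "mpoly_eval \<kappa> g (\<Sum>i\<in>A. f i) = (\<Sum>i\<in>A. mpoly_eval \<kappa> g (f i))"
  by (induction A rule: infinite_finite_induct) (simp_all add: eval_zero eval_add)

lemma eval_mult: "mpoly_eval \<kappa> g (f * f') = mpoly_eval \<kappa> g f * mpoly_eval \<kappa> g f'"
proof -
  have "f * f' = (\<Sum>m\<in>Poly_Mapping.keys f. \<Sum>m'\<in>Poly_Mapping.keys f'.
      Poly_Mapping.single (m + m') (Poly_Mapping.lookup f m * Poly_Mapping.lookup f' m'))"
    by (subst poly_mapping_sum_single[of f], subst poly_mapping_sum_single[of f'])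
      (simp only: sum_product mult_single)
  then show ?thesis
    by (simp only: eval_sum eval_single mpoly_eval_def[of _ _ f] mpoly_eval_def[of _ _ f'] sum_product
        monomial_eval_add \<kappa>_mult) (simp only: ac_simps)
qed

end

section \<open>Homogeneous pieces of the weighted polynomial ring\<close>

abbreviation mpolys :: "nat \<Rightarrow> 'k::field mpoly set" where
  "mpolys N \<equiv> carrier (mpoly_ring N)"

lemma mpolys_iff: "f \<in> mpolys N \<longleftrightarrow> (\<forall>m\<in>Poly_Mapping.keys f. Poly_Mapping.keys m \<subseteq> {..<N})"
  by (simp add: mpoly_ring_def ring_on_def)

lemma mpoly_ring_ops [simp]:
  "mult (mpoly_ring N) = (*)" "one (mpoly_ring N) = 1" "zero (mpoly_ring N) = 0" "add (mpoly_ring N) = (+)"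
  by (simp_all add: mpoly_ring_def ring_on_def)

lemma mpolys_const: "mpoly_const c \<in> mpolys N"
  by (auto simp: mpolys_iff mpoly_const_def)

lemma mpoly_piece_iff:
  "f \<in> mpoly_piece N w e \<longleftrightarrow>
    (\<forall>m\<in>Poly_Mapping.keys f. Poly_Mapping.keys m \<subseteq> {..<N} \<and> weight w m = e)"
  by (auto simp: mpoly_piece_def mpolys_iff weight_def)

lemma mpoly_piece_mpolys: "mpoly_piece N w e \<subseteq> mpolys N"
  by (auto simp: mpoly_piece_def)

lemma mpoly_piece_zero: "0 \<in> mpoly_piece N w e"
  by (simp add: mpoly_piece_iff)

lemma mpoly_piece_add: "f \<in> mpoly_piece N w e \<Longrightarrow> f' \<in> mpoly_piece N w e \<Longrightarrow> f + f' \<in> mpoly_piece N w e"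
  using keys_add[of f f'] by (auto simp: mpoly_piece_iff)

lemma mpoly_piece_sum: "(\<And>i. i \<in> A \<Longrightarrow> f i \<in> mpoly_piece N w e) \<Longrightarrow> (\<Sum>i\<in>A. f i) \<in> mpoly_piece N w e"
  by (induction A rule: infinite_finite_induct) (simp_all add: mpoly_piece_zero mpoly_piece_add)

lemma mpoly_piece_mult:
  assumes "f \<in> mpoly_piece N w e" "f' \<in> mpoly_piece N w e'"
  shows "f * f' \<in> mpoly_piece N w (e + e')"
  unfolding mpoly_piece_iff
proof
  fix m assume "m \<in> Poly_Mapping.keys (f * f')"
  then obtain a b where m: "m = a + b" "a \<in> Poly_Mapping.keys f" "b \<in> Poly_Mapping.keys f'"
    using keys_mult[of f f'] by blast
  then show "Poly_Mapping.keys m \<subseteq> {..<N} \<and> weight w m = e + e'"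
    using assms keys_add[of a b] unfolding mpoly_piece_iff by (fastforce simp: weight_add)
qed

lemma mpoly_piece_single:
  "Poly_Mapping.keys m \<subseteq> {..<N} \<Longrightarrow> weight w m = e \<Longrightarrow> Poly_Mapping.single m c \<in> mpoly_piece N w e"
  by (auto simp: mpoly_piece_iff)

lemma mpoly_piece_const: "mpoly_const c \<in> mpoly_piece N w 0"
  unfolding mpoly_const_def by (rule mpoly_piece_single) simp_all

lemma mpoly_piece_const_mult:
  "f \<in> mpoly_piece N w e \<Longrightarrow> mpoly_const c * f \<in> mpoly_piece N w e"
  using mpoly_piece_mult[OF mpoly_piece_const[of c N w], of f e] by simp

lemma mpoly_piece_diff: "f \<in> mpoly_piece N w e \<Longrightarrow> f' \<in> mpoly_piece N w e \<Longrightarrow> f - f' \<in> mpoly_piece N w e"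
  using mpoly_piece_add[of f N w e "- f'"] mpoly_piece_const_mult[of f' N w e "- 1"]
  by (simp add: mpoly_const_def single_uminus)

lemma mpoly_piece_induct [consumes 1, case_names zero add single]:
  assumes "f \<in> mpoly_piece N w e"
    and "Q 0" and "\<And>f f'. Q f \<Longrightarrow> Q f' \<Longrightarrow> Q (f + f')"
    and "\<And>m c. Poly_Mapping.keys m \<subseteq> {..<N} \<Longrightarrow> weight w m = e \<Longrightarrow> Q (Poly_Mapping.single m c)"
  shows "Q f"
proof -
  have "Q (\<Sum>m\<in>A. Poly_Mapping.single m (Poly_Mapping.lookup f m))" if "A \<subseteq> Poly_Mapping.keys f" for A
    using that
    by (induction A rule: infinite_finite_induct) (use assms in \<open>auto simp: mpoly_piece_iff\<close>)
  then show ?thesis using poly_mapping_sum_single[of f] by (metis order_refl)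
qed

lemma mpoly_homogeneous_decomposition:
  assumes "f \<in> mpolys N"
  obtains E F where "finite E" "f = (\<Sum>e\<in>E. F e)" "\<And>e. F e \<in> mpoly_piece N w e"
proof
  let ?K = "Poly_Mapping.keys f" and ?t = "\<lambda>m. Poly_Mapping.single m (Poly_Mapping.lookup f m)"
  show "finite (weight w ` ?K)" by simp
  show "f = (\<Sum>e\<in>weight w ` ?K. \<Sum>m\<in>{m. m \<in> ?K \<and> weight w m = e}. ?t m)"
    using poly_mapping_sum_single[of f] sum.image_gen[of ?K ?t "weight w"] by simp
  show "(\<Sum>m\<in>{m. m \<in> ?K \<and> weight w m = e}. ?t m) \<in> mpoly_piece N w e" for e
    using assms by (intro mpoly_piece_sum mpoly_piece_single) (auto simp: mpolys_iff)
qed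


section \<open>The cone of exponents\<close>

text \<open>Here \<open>l\<close> stands for the least common multiple of all denominators and
  \<open>L i\<close> for that of the denominators other than the \<open>i\<close>-th. Thus
  \<open>L i\<close> clears every \<open>\<alpha> j\<close> with \<open>j \<noteq> i\<close>, and
  \<open>l\<close> times the degree is a positive integer, hence at least \<open>1\<close>.\<close>

locale positive_divisor = rational_divisor n P \<alpha> i\<^sub>0 j\<^sub>0
  for n and P :: "nat \<Rightarrow> 'k::field poly place" and \<alpha> i\<^sub>0 j\<^sub>0 +
  fixes L :: "nat \<Rightarrow> nat" and l :: nat
  assumes l_deg: "of_nat l * (\<Sum>i=1..n. \<alpha> i) \<ge> 1"
    and L_pos: "i \<in> {1..n} \<Longrightarrow> L i > 0"
    and L_int: "i \<in> {1..n} \<Longrightarrow> j \<in> {1..n} \<Longrightarrow> i \<noteq> j \<Longrightarrow> of_nat (L i) * \<alpha> j \<in> \<int>"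
begin

definition deg_D :: rat where
  "deg_D = (\<Sum>i=1..n. \<alpha> i)"

definition B :: nat where
  "B = (\<Sum>i=1..n. L i)"

definition bound :: nat where
  "bound = max (l + B) (2 * B)"

text \<open>The primitive lattice point on the edge of the cone where only the \<open>i\<close>-th slack is positive.\<close>

definition ray :: "nat \<Rightarrow> nat \<Rightarrow> int" where
  "ray i = (\<lambda>j. if j \<notin> {1..n} then 0 else if j = i then \<Sum>k\<in>{1..n} - {i}. flr (L i) k else - flr (L i) j)"

lemma deg_D_pos: "deg_D > 0"
proof (rule ccontr)
  assume "\<not> deg_D > 0"
  then have "of_nat l * deg_D \<le> 0" by (simp add: mult_nonneg_nonpos)
  then show False using l_deg by (simp add: deg_D_def)
qed

text \<open>There is a second index, and its \<open>L j\<close> is positive. The strict inequality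
  places the edge vectors among the generators.\<close>

lemma L_less_B:
  assumes "i \<in> {1..n}"
  shows "L i < B"
proof -
  obtain j where j: "j \<in> {1..n}" "j \<noteq> i" using i0(1) j0 by blast
  have "L i + L j = sum L {i, j}" using j(2) by simp
  also have "\<dots> \<le> B" unfolding B_def by (rule sum_mono2) (use assms j in auto)
  finally show ?thesis using L_pos[OF j(1)] by simp
qed

lemma B_pos: "B > 0"
  using L_less_B[OF i0(1)] by simp

lemma flr_L:
  assumes "i \<in> {1..n}" "j \<in> {1..n}" "i \<noteq> j"
  shows "of_int (flr (L i) j) = of_nat (L i) * \<alpha> j"
  using L_int[OF assms] unfolding flr_def by (auto elim: Ints_cases)

text \<open>The choice of \<open>L i\<close> makes all slacks but the \<open>i\<close>-th vanish, so
  that one carries the whole total \<open>L i * deg_D\<close>.\<close>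

lemma ray_slack:
  assumes "i \<in> {1..n}" "j \<in> {1..n}"
  shows "of_int (ray i j) + of_nat (L i) * \<alpha> j = (if j = i then of_nat (L i) * deg_D else 0)"
proof (cases "j = i")
  case True
  have "of_int (ray i j) = (\<Sum>k\<in>{1..n} - {i}. of_nat (L i) * \<alpha> k)"
    using True assms flr_L[OF assms(1)] by (simp add: ray_def)
  moreover have "deg_D = \<alpha> i + (\<Sum>k\<in>{1..n} - {i}. \<alpha> k)"
    unfolding deg_D_def by (rule sum.remove) (use assms in auto)
  ultimately show ?thesis using True by (simp add: sum_distrib_left algebra_simps)
next
  case False
  then have "ray i j = - flr (L i) j" using assms by (simp add: ray_def)
  then show ?thesis using False flr_L[OF assms] by simp
qed

lemma ray_sum:
  assumes "i \<in> {1..n}"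
  shows "(\<Sum>j=1..n. ray i j) = 0"
proof -
  have "(\<Sum>j=1..n. ray i j) = ray i i + (\<Sum>j\<in>{1..n} - {i}. ray i j)"
    by (rule sum.remove) (use assms in auto)
  also have "(\<Sum>j\<in>{1..n} - {i}. ray i j) = (\<Sum>j\<in>{1..n} - {i}. - flr (L i) j)"
    by (intro sum.cong) (auto simp: ray_def)
  finally show ?thesis using assms by (simp add: ray_def sum_negf)
qed

lemma ray_cone:
  assumes i: "i \<in> {1..n}"
  shows "ray i \<in> cone 0 (L i)"
proof -
  have "of_int (ray i j) + of_nat (L i) * \<alpha> j \<ge> 0" if "j \<in> {1..n}" for j
    unfolding ray_slack[OF i that] using deg_D_pos by simp
  moreover have "ray i j = 0" if "j \<notin> {1..n}" for j
    using that by (simp add: ray_def)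
  ultimately show ?thesis
    using ray_sum[OF i] unfolding cone_def by simp
qed

lemma cone_add:
  assumes "c \<in> cone t d" "c' \<in> cone t' d'"
  shows "(\<lambda>i. c i + c' i) \<in> cone (t + t') (d + d')"
proof -
  have "of_int (c i + c' i) + of_nat (d + d') * \<alpha> i \<ge> 0" if "i \<in> {1..n}" for i
  proof -
    have "of_int (c i) + of_nat d * \<alpha> i \<ge> 0" "of_int (c' i) + of_nat d' * \<alpha> i \<ge> 0"
      using assms that unfolding cone_def by blast+
    then show ?thesis by (simp add: algebra_simps)
  qed
  then show ?thesis using assms unfolding cone_def by (auto simp: sum.distrib)
qed

lemma cone_slack_sum:
  assumes "c \<in> cone t d"
  shows "(\<Sum>i=1..n. of_int (c i) + of_nat d * \<alpha> i) = of_nat d * deg_D - of_nat t"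
proof -
  have "(\<Sum>i=1..n. c i) = - int t" using assms unfolding cone_def by blast
  then have "(\<Sum>i=1..n. rat_of_int (c i)) = - of_nat t"
    by (metis of_int_sum of_int_minus of_int_of_nat_eq)
  then show ?thesis by (simp add: sum.distrib sum_distrib_left deg_D_def)
qed

section \<open>Splitting off edge vectors\<close>

definition sub_ray :: "nat \<Rightarrow> (nat \<Rightarrow> int) \<Rightarrow> nat \<Rightarrow> int" where
  "sub_ray i c = (\<lambda>j. c j - ray i j)"

text \<open>The condition compares the \<open>i\<close>-th slack with that of the
  \<open>i\<close>-th edge vector. As the edge vector has no other slack, subtracting it then stays
  in the cone.\<close>

definition reducible :: "nat \<Rightarrow> nat \<Rightarrow> (nat \<Rightarrow> int) \<Rightarrow> bool" where
  "reducible i d c \<longleftrightarrow> i \<in> {1..n} \<and> of_int (c i) + of_nat d * \<alpha> i \<ge> of_nat (L i) * deg_D"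

text \<open>No slack exceeds the total \<open>d * deg_D - t\<close>. This makes the natural number
  subtraction \<open>d - L i\<close> exact.\<close>

lemma reducible_degree:
  assumes c: "c \<in> cone t d" and r: "reducible i d c"
  shows "L i \<le> d"
proof -
  have i: "i \<in> {1..n}" using r by (simp add: reducible_def)
  have "of_int (c i) + of_nat d * \<alpha> i \<le> (\<Sum>i=1..n. of_int (c i) + of_nat d * \<alpha> i)"
    by (rule member_le_sum[OF i]) (use c in \<open>auto simp: cone_def\<close>)
  then have "of_nat (L i) * deg_D \<le> of_nat d * deg_D"
    using r cone_slack_sum[OF c] by (simp add: reducible_def)
  then show ?thesis using deg_D_pos by simp
qed

lemma sub_ray_slack:
  assumes "i \<in> {1..n}" "j \<in> {1..n}" "L i \<le> d"
  shows "of_int (sub_ray i c j) + of_nat (d - L i) * \<alpha> j =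
    of_int (c j) + of_nat d * \<alpha> j - (if j = i then of_nat (L i) * deg_D else 0)"
  unfolding ray_slack[OF assms(1,2), symmetric] using assms(3)
  by (simp add: sub_ray_def of_nat_diff algebra_simps)

lemma sub_ray_cone:
  assumes c: "c \<in> cone t d" and r: "reducible i d c"
  shows "sub_ray i c \<in> cone t (d - L i)"
proof -
  have i: "i \<in> {1..n}" using r by (simp add: reducible_def)
  have "of_int (sub_ray i c j) + of_nat (d - L i) * \<alpha> j \<ge> 0" if j: "j \<in> {1..n}" for j
    unfolding sub_ray_slack[OF i j reducible_degree[OF c r]]
    using c r j by (auto simp: cone_def reducible_def)
  moreover have "(\<Sum>j=1..n. sub_ray i c j) = - int t"
    unfolding sub_ray_def sum_subtractf ray_sum[OF i] using c by (simp add: cone_def)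
  moreover have "sub_ray i c j = 0" if "j \<notin> {1..n}" for j
  proof -
    have "ray i j = 0" "c j = 0" using that c unfolding ray_def cone_def by auto
    then show ?thesis by (simp add: sub_ray_def)
  qed
  ultimately show ?thesis unfolding cone_def by blast
qed

text \<open>Subtracting one edge vector leaves the other slacks unchanged, so two different ones can
  be split off in either order.\<close>

lemma reducible_sub_ray:
  assumes "c \<in> cone t d" "reducible i d c" "reducible j d c" "i \<noteq> j"
  shows "reducible j (d - L i) (sub_ray i c)"
proof -
  have i: "i \<in> {1..n}" and j: "j \<in> {1..n}" using assms by (auto simp: reducible_def)
  show ?thesis
    using sub_ray_slack[OF i j reducible_degree[OF assms(1,2)], of c] assms(3,4)
    by (simp add: reducible_def)
qed

lemma ray_add_sub_ray: "(\<lambda>j. ray i j + sub_ray i c j) = c"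
  by (simp add: sub_ray_def)

text \<open>If every slack were below that of its edge vector, the total
  \<open>d * deg_D - t\<close> would be below \<open>B * deg_D\<close>. As \<open>l * deg_D\<close>
  is at least \<open>1\<close>, the \<open>t * l\<close> additional degrees compensate for
  \<open>t\<close>; the case \<open>t = 1\<close> is the origin of \<open>l\<close> in
  \<open>bound\<close>.\<close>

lemma exists_reducible:
  assumes c: "c \<in> cone t d" and d: "B + t * l \<le> d"
  shows "\<exists>i. reducible i d c"
proof (rule ccontr)
  assume "\<not> ?thesis"
  then have less: "of_int (c i) + of_nat d * \<alpha> i < of_nat (L i) * deg_D" if "i \<in> {1..n}" for i
    using that unfolding reducible_def by (meson not_le)
  have "(\<Sum>i=1..n. of_int (c i) + of_nat d * \<alpha> i) < (\<Sum>i=1..n. of_nat (L i) * deg_D)"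
    by (rule sum_strict_mono) (use i0(1) less in auto)
  then have "of_nat d * deg_D - of_nat t < of_nat B * deg_D"
    unfolding cone_slack_sum[OF c] by (simp add: B_def sum_distrib_right)
  moreover have "of_nat (B + t * l) * deg_D \<le> of_nat d * deg_D"
    using d deg_D_pos by (intro mult_right_mono) (simp_all only: of_nat_le_iff less_imp_le)
  moreover have "of_nat t * 1 \<le> of_nat t * (of_nat l * deg_D)"
    using l_deg by (intro mult_left_mono) (simp_all add: deg_D_def)
  ultimately show False by (simp add: algebra_simps)
qed

text \<open>The slack conditions bound each exponent from below, and since the exponents sum to
  \<open>0\<close> this also bounds each from above.\<close>

lemma finite_cone: "finite (cone 0 d)"
proof -
  define F where "F = (\<Sum>k=1..n. \<bar>flr d k\<bar>)"
  have "c i \<in> {- F..F}" if c: "c \<in> cone 0 d" and i: "i \<in> {1..n}" for c i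
  proof -
    have lower: "- flr d k \<le> c k" if "k \<in> {1..n}" for k
    proof -
      have "c k + flr d k \<ge> 0" using c that unfolding cone_def slack_iff by blast
      then show ?thesis by simp
    qed
    have "\<bar>flr d i\<bar> \<le> F" unfolding F_def by (rule member_le_sum[OF i]) auto
    moreover have "(\<Sum>k=1..n. c k) = c i + (\<Sum>k\<in>{1..n} - {i}. c k)"
      by (rule sum.remove[OF _ i]) simp
    moreover have "(\<Sum>k=1..n. c k) = 0" using c by (simp add: cone_def)
    moreover have "(\<Sum>k\<in>{1..n} - {i}. - flr d k) \<le> (\<Sum>k\<in>{1..n} - {i}. c k)"
      by (rule sum_mono) (use lower in auto)
    moreover have "(\<Sum>k\<in>{1..n} - {i}. flr d k) \<le> (\<Sum>k\<in>{1..n} - {i}. \<bar>flr d k\<bar>)"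
      by (rule sum_mono) simp
    moreover have "(\<Sum>k\<in>{1..n} - {i}. \<bar>flr d k\<bar>) \<le> F"
      unfolding F_def by (rule sum_mono2) auto
    ultimately show ?thesis using lower[OF i] by (simp add: sum_negf)
  qed
  then have "cone 0 d \<subseteq> {c. \<forall>i. (i \<in> {1..n} \<longrightarrow> c i \<in> {- F..F}) \<and> (i \<notin> {1..n} \<longrightarrow> c i = 0)}"
    unfolding cone_def by blast
  then show ?thesis
    by (rule finite_subset) (rule finite_set_of_finite_funs; simp)
qed

lemma zero_cone: "(\<lambda>_. 0) \<in> cone 0 0"
  by (simp add: cone_def)

definition unit :: "nat \<Rightarrow> nat \<Rightarrow> int" where
  "unit a = (\<lambda>i. if i = a then 1 else 0)"

text \<open>In this way one exponent vector with sum \<open>-1\<close> yields all terms of a linear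
  relation between the \<open>s a\<close>.\<close>

lemma cone_add_unit:
  assumes c: "c \<in> cone (Suc t) d" and a: "a \<in> {1..n}"
  shows "(\<lambda>i. c i + unit a i) \<in> cone t d"
proof -
  have "(\<Sum>i=1..n. c i + unit a i) = - int t"
    using c a by (simp add: sum.distrib unit_def cone_def)
  moreover have "of_int (c i + unit a i) + of_nat d * \<alpha> i \<ge> 0" if "i \<in> {1..n}" for i
  proof -
    have "of_int (c i) + of_nat d * \<alpha> i \<ge> 0" using c that unfolding cone_def by blast
    moreover have "rat_of_int (unit a i) \<ge> 0" by (simp add: unit_def)
    ultimately show ?thesis unfolding of_int_add by linarith
  qed
  moreover have "c i + unit a i = 0" if "i \<notin> {1..n}" for i
    using c a that by (auto simp: unit_def cone_def)
  ultimately show ?thesis unfolding cone_def by blast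
qed

lemma z_add_unit: "a \<in> {1..n} \<Longrightarrow> z (\<lambda>i. c i + unit a i) = s a * z c"
  unfolding z_add unit_def by (simp add: z_single)

end


section \<open>Lattice points of small degree as generators\<close>

text \<open>One variable per lattice point of degree less than \<open>B\<close>, possibly with
  repetitions. The zero exponent in degree \<open>0\<close> is among them, so some variable has
  weight \<open>0\<close> and value \<open>1\<close>.\<close>

locale canonical_generators = positive_divisor n P \<alpha> i\<^sub>0 j\<^sub>0 L l
  for n and P :: "nat \<Rightarrow> 'k::field poly place" and \<alpha> i\<^sub>0 j\<^sub>0 L l +
  fixes N :: nat and gen :: "nat \<Rightarrow> nat \<times> (nat \<Rightarrow> int)"
  assumes gen: "gen ` {..<N} = {(d, c). d < B \<and> c \<in> cone 0 d}"
begin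

definition w :: "nat \<Rightarrow> nat" where
  "w j = fst (gen j)"

definition gval :: "nat \<Rightarrow> 'k poly fract poly" where
  "gval j = Polynomial.monom (z (snd (gen j))) (w j)"

definition \<phi> :: "'k mpoly \<Rightarrow> 'k poly fract poly" where
  "\<phi> = mpoly_eval (\<lambda>c. [:fconst c:]) gval"

sublocale eval_hom "\<lambda>c. [:fconst c:]" gval
  rewrites "mpoly_eval (\<lambda>c. [:fconst c:]) gval = \<phi>"
proof -
  show "eval_hom (\<lambda>c :: 'k. [:fconst c:])"
  proof
    show "[:fconst (a + b):] = [:fconst a:] + [:fconst b:]" for a b :: 'k
      unfolding fconst_add by simp
    show "[:fconst (a * b):] = [:fconst a:] * [:fconst b:]" for a b :: 'k
      unfolding fconst_mult by simp
    show "[:fconst 1:] = (1 :: 'k poly fract poly)"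
      unfolding fconst_one by (rule pCons_one)
  qed
qed (simp add: \<phi>_def)

definition lift :: "nat \<Rightarrow> (nat \<Rightarrow> int) \<Rightarrow> 'k mpoly \<Rightarrow> bool" where
  "lift d c F \<longleftrightarrow> F \<in> mpoly_piece N w d \<and> \<phi> F = Polynomial.monom (z c) d"

definition relations :: "nat \<Rightarrow> 'k mpoly set" where
  "relations e = {f \<in> mpoly_piece N w e. \<phi> f = 0}"

lemma gen_cone:
  assumes "j < N"
  shows "snd (gen j) \<in> cone 0 (w j)" "w j < B"
proof -
  have "gen j \<in> gen ` {..<N}" using assms by simp
  then have "gen j \<in> {(d, c). d < B \<and> c \<in> cone 0 d}" unfolding gen .
  then show "snd (gen j) \<in> cone 0 (w j)" "w j < B" by (auto simp: w_def)
qed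

lemma \<phi>_single: "\<phi> (Poly_Mapping.single m 1) = monomial_eval gval m"
  by (simp add: eval_single fconst_one pCons_one)

lemma lift_mult:
  assumes "lift d c F" "lift d' c' F'"
  shows "lift (d + d') (\<lambda>i. c i + c' i) (F * F')"
  using assms by (simp add: lift_def mpoly_piece_mult eval_mult mult_monom z_add)

lemma lift_variable:
  assumes "j < N"
  shows "lift (w j) (snd (gen j)) (Poly_Mapping.single (Poly_Mapping.single j 1) 1)"
  unfolding lift_def using assms by (auto simp: \<phi>_single gval_def intro!: mpoly_piece_single)

lemma exists_variable:
  assumes "d < B" "c \<in> cone 0 d"
  shows "\<exists>j<N. gen j = (d, c)"
proof -
  have "(d, c) \<in> gen ` {..<N}" unfolding gen using assms by simp
  then show ?thesis by auto
qed

text \<open>The variable of the \<open>i\<close>-th edge vector, which is a generator because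
  \<open>L i < B\<close>. The enumeration may repeat a point, hence the choice of an index.\<close>

definition ray_var :: "nat \<Rightarrow> 'k mpoly" where
  "ray_var i = Poly_Mapping.single (Poly_Mapping.single (SOME j. j < N \<and> gen j = (L i, ray i)) 1) 1"

lemma lift_ray_var:
  assumes i: "i \<in> {1..n}"
  shows "lift (L i) (ray i) (ray_var i)"
proof -
  have "\<exists>j. j < N \<and> gen j = (L i, ray i)"
    using exists_variable[OF L_less_B[OF i] ray_cone[OF i]] by blast
  from someI_ex[OF this] show ?thesis
    unfolding ray_var_def using lift_variable by (metis fst_conv snd_conv w_def)
qed

lemma lift_ray_mult:
  assumes "c \<in> cone t d" "reducible i d c" "lift (d - L i) (sub_ray i c) F"
  shows "lift d c (ray_var i * F)"
proof -
  have "i \<in> {1..n}" using assms(2) by (simp add: reducible_def)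
  from lift_mult[OF lift_ray_var[OF this] assms(3)] reducible_degree[OF assms(1,2)]
  show ?thesis by (simp add: ray_add_sub_ray)
qed

text \<open>Below degree \<open>B\<close> the lattice point is a variable. From \<open>B\<close> on
  an edge vector splits off, and its variable times a lift of the remainder is a lift.\<close>

lemma exists_lift: "c \<in> cone 0 d \<Longrightarrow> \<exists>F. lift d c F"
proof (induction d arbitrary: c rule: less_induct)
  case (less d)
  show ?case
  proof (cases "d < B")
    case True
    from exists_variable[OF this less.prems] lift_variable show ?thesis
      by (metis fst_conv snd_conv w_def)
  next
    case False
    with exists_reducible[OF less.prems] obtain i where i: "reducible i d c" by auto
    then have "L i > 0" using L_pos by (simp add: reducible_def)
    with reducible_degree[OF less.prems i] have "d - L i < d" by linarith
    from less.IH[OF this sub_ray_cone[OF less.prems i]] show ?thesis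
      using lift_ray_mult[OF less.prems i] by blast
  qed
qed

text \<open>Lattice points add up when their products are multiplied, so a monomial takes a single
  product \<open>z c\<close> as its value rather than a combination of several.\<close>

lemma monomial_value:
  assumes "Poly_Mapping.keys m \<subseteq> {..<N}"
  shows "\<exists>c\<in>cone 0 (weight w m). monomial_eval gval m = Polynomial.monom (z c) (weight w m)"
proof -
  let ?Q = "\<lambda>d F. \<exists>c\<in>cone 0 d. F = Polynomial.monom (z c) d"
  have one: "?Q 0 1"
    by (intro bexI[OF _ zero_cone]) (simp add: z_zero monom_0 pCons_one)
  have mult: "?Q (d + d') (F * F')" if F: "?Q d F" and F': "?Q d' F'" for d d' F F'
  proof -
    obtain c c' where "c \<in> cone 0 d" "F = Polynomial.monom (z c) d"
      "c' \<in> cone 0 d'" "F' = Polynomial.monom (z c') d'" using F F' by blast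
    with cone_add[of c 0 d c' 0 d'] show ?thesis
      by (intro bexI[of _ "\<lambda>i. c i + c' i"]) (simp_all add: mult_monom z_add)
  qed
  have power: "?Q (k * w j) (gval j ^ k)" if "j < N" for j k
  proof (induction k)
    case (Suc k)
    have "?Q (w j) (gval j)" using gen_cone[OF that] unfolding gval_def by blast
    from mult[OF this Suc] show ?case by simp
  qed (use one in simp)
  have "?Q (\<Sum>j\<in>A. Poly_Mapping.lookup m j * w j) (\<Prod>j\<in>A. gval j ^ Poly_Mapping.lookup m j)"
    if "A \<subseteq> {..<N}" for A
    using that
  proof (induction A rule: infinite_finite_induct)
    case (insert j A)
    then show ?case using mult[OF power[of j "Poly_Mapping.lookup m j"]] by simp
  qed (use one in simp_all)
  from this[OF assms] show ?thesis by (simp add: weight_def monomial_eval_def)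
qed

lemma \<phi>_piece:
  assumes "f \<in> mpoly_piece N w e"
  shows "\<phi> f \<in> canonical_piece D e"
  using assms
proof (induction rule: mpoly_piece_induct)
  case zero
  show ?case unfolding canonical_piece_def by (rule image_eqI[OF _ H0_zero]) (simp add: eval_zero)
next
  case (add f f')
  then obtain a b where "a \<in> H0 (floor_multiple e D)" "\<phi> f = Polynomial.monom a e"
    "b \<in> H0 (floor_multiple e D)" "\<phi> f' = Polynomial.monom b e" unfolding canonical_piece_def by blast
  then show ?case unfolding canonical_piece_def
    by (intro image_eqI[OF _ H0_add[of a _ b]]) (simp_all add: eval_add add_monom)
next
  case (single m b)
  obtain c where c: "c \<in> cone 0 e" "monomial_eval gval m = Polynomial.monom (z c) e"
    using monomial_value[OF single(1)] single(2) by blast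
  show ?case unfolding canonical_piece_def
    by (rule image_eqI[OF _ H0_const_mult[OF z_in_H0[OF c(1)], of b]]) (simp add: eval_single c(2) smult_monom)
qed

text \<open>The degree \<open>e\<close> part is spanned by the \<open>z (normal e k)\<close>, and
  each of these exponents is a lattice point of the cone, hence has a lift.\<close>

lemma \<phi>_surj_piece:
  assumes "F \<in> canonical_piece D e"
  shows "\<exists>f\<in>mpoly_piece N w e. \<phi> f = F"
proof -
  obtain a where a: "a \<in> H0 (floor_multiple e D)" "F = Polynomial.monom a e"
    using assms unfolding canonical_piece_def by blast
  let ?K = "nat (deg_floor e + 1)"
  obtain b where b: "a = (\<Sum>k<?K. fconst (b k) * z (normal e k))" using H0_span[OF a(1)] by blast
  have "\<exists>X. lift e (normal e k) X" if "k < ?K" for k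
    using that by (intro exists_lift normal_cone) linarith
  then obtain X where X: "\<And>k. k < ?K \<Longrightarrow> lift e (normal e k) (X k)" by metis
  let ?f = "\<Sum>k<?K. mpoly_const (b k) * X k"
  have "?f \<in> mpoly_piece N w e"
    using X by (intro mpoly_piece_sum mpoly_piece_const_mult) (auto simp: lift_def)
  moreover have "\<phi> ?f = (\<Sum>k<?K. Polynomial.monom (fconst (b k) * z (normal e k)) e)"
    using X unfolding eval_sum by (intro sum.cong) (simp_all add: eval_mult eval_const lift_def smult_monom)
  moreover have "\<dots> = F" by (simp add: a(2) b monom_sum)
  ultimately show ?thesis by auto
qed

end


section \<open>Relations of large degree\<close>

text \<open>The inductive step on the degree: \<open>J\<close> is an ideal of relations containing
  all those of degree below \<open>e\<close>, and the aim is to reach degree \<open>e\<close>. It is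
  applied to the ideal generated by the relations of degree below \<open>bound\<close>.\<close>

locale relation_ideal = canonical_generators n P \<alpha> i\<^sub>0 j\<^sub>0 L l N gen
  for n and P :: "nat \<Rightarrow> 'k::field poly place" and \<alpha> i\<^sub>0 j\<^sub>0 L l N gen +
  fixes J :: "'k mpoly set" and e :: nat
  assumes J_zero: "0 \<in> J"
    and J_add: "a \<in> J \<Longrightarrow> b \<in> J \<Longrightarrow> a + b \<in> J"
    and J_mult: "a \<in> mpolys N \<Longrightarrow> b \<in> J \<Longrightarrow> a * b \<in> J"
    and J_kernel: "a \<in> J \<Longrightarrow> \<phi> a = 0"
    and J_low: "e' < e \<Longrightarrow> relations e' \<subseteq> J"
    and e_bound: "bound \<le> e"
begin

lemma e_bounds: "2 * B \<le> e" "B + l \<le> e"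
  using e_bound by (simp_all add: bound_def)

lemma J_const: "a \<in> J \<Longrightarrow> mpoly_const b * a \<in> J"
  using J_mult mpolys_const by blast

lemma J_diff:
  assumes "a \<in> J" "b \<in> J"
  shows "a - b \<in> J"
proof -
  have "a + mpoly_const (- 1) * b \<in> J" using assms J_add J_const by blast
  then show ?thesis by (simp add: mpoly_const_def single_uminus)
qed

lemma lift_mpolys: "lift d c F \<Longrightarrow> F \<in> mpolys N"
  using mpoly_piece_mpolys by (auto simp: lift_def)

lemma lift_unique_low:
  assumes "d < e" "lift d c F" "lift d c F'"
  shows "F - F' \<in> J"
proof -
  have "F - F' \<in> relations d"
    using assms(2,3) by (simp add: relations_def lift_def mpoly_piece_diff eval_diff)
  then show ?thesis using J_low[OF assms(1)] by blast
qed

text \<open>A lift with an explicit edge variable as a factor. The cofactor has degree below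
  \<open>e\<close>, where every relation is already in \<open>J\<close>.\<close>

definition ray_lift :: "(nat \<Rightarrow> int) \<Rightarrow> 'k mpoly \<Rightarrow> bool" where
  "ray_lift c F \<longleftrightarrow> (\<exists>i F'. reducible i e c \<and> lift (e - L i) (sub_ray i c) F' \<and> F = ray_var i * F')"

lemma ray_liftI: "reducible i e c \<Longrightarrow> lift (e - L i) (sub_ray i c) F \<Longrightarrow> ray_lift c (ray_var i * F)"
  unfolding ray_lift_def by blast

lemma ray_lift_lift: "c \<in> cone 0 e \<Longrightarrow> ray_lift c F \<Longrightarrow> lift e c F"
  unfolding ray_lift_def using lift_ray_mult by blast

lemma exists_ray_lift:
  assumes "c \<in> cone 0 e"
  shows "\<exists>F. ray_lift c F"
proof -
  obtain i where i: "reducible i e c" using exists_reducible[OF assms] e_bounds(2) by auto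
  obtain F where "lift (e - L i) (sub_ray i c) F" using exists_lift[OF sub_ray_cone[OF assms i]] by blast
  then show ?thesis using ray_liftI[OF i] by blast
qed

lemma L_reducible:
  assumes "c \<in> cone t d" "reducible i d c"
  shows "i \<in> {1..n}" "0 < L i" "L i \<le> d" "d - L i < d"
proof -
  show i: "i \<in> {1..n}" using assms(2) by (simp add: reducible_def)
  show "0 < L i" "L i \<le> d" using L_pos[OF i] reducible_degree[OF assms] by simp_all
  then show "d - L i < d" by linarith
qed

text \<open>If both lifts use the same edge vector, their cofactors agree modulo \<open>J\<close>.
  If not, both edge vectors can be split off together, and each lift is congruent to the product of
  the two edge variables with one lift \<open>H\<close> of the remainder.\<close>

lemma ray_lift_unique:
  assumes c: "c \<in> cone 0 e" and F: "ray_lift c F" and G: "ray_lift c G"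
  shows "F - G \<in> J"
proof -
  obtain i F' where i: "reducible i e c" "lift (e - L i) (sub_ray i c) F'" "F = ray_var i * F'"
    using F unfolding ray_lift_def by blast
  obtain j G' where j: "reducible j e c" "lift (e - L j) (sub_ray j c) G'" "G = ray_var j * G'"
    using G unfolding ray_lift_def by blast
  note Li = L_reducible[OF c i(1)] and Lj = L_reducible[OF c j(1)]
  have vi: "ray_var i \<in> mpolys N" and vj: "ray_var j \<in> mpolys N"
    using lift_mpolys[OF lift_ray_var] Li(1) Lj(1) by blast+
  show ?thesis
  proof (cases "i = j")
    case True
    have "F' - G' \<in> J" using lift_unique_low[OF Li(4) i(2)] j(2) True by blast
    then have "ray_var i * (F' - G') \<in> J" using J_mult[OF vi] by blast
    then show ?thesis using True i(3) j(3) by (simp add: algebra_simps)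
  next
    case False
    have red: "reducible j (e - L i) (sub_ray i c)" "reducible i (e - L j) (sub_ray j c)"
      using reducible_sub_ray[OF c] i(1) j(1) False by auto
    have swap: "sub_ray i (sub_ray j c) = sub_ray j (sub_ray i c)"
      unfolding sub_ray_def by auto
    have ci: "sub_ray i c \<in> cone 0 (e - L i)" and cj: "sub_ray j c \<in> cone 0 (e - L j)"
      using sub_ray_cone[OF c] i(1) j(1) by blast+
    obtain H where H: "lift (e - L i - L j) (sub_ray j (sub_ray i c)) H"
      using exists_lift[OF sub_ray_cone[OF ci red(1)]] by blast
    have H': "lift (e - L j - L i) (sub_ray i (sub_ray j c)) H"
      using H unfolding swap by (simp add: add.commute)
    have "F' - ray_var j * H \<in> J"
      by (rule lift_unique_low[OF Li(4) i(2) lift_ray_mult[OF ci red(1) H]])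
    moreover have "G' - ray_var i * H \<in> J"
      by (rule lift_unique_low[OF Lj(4) j(2) lift_ray_mult[OF cj red(2) H']])
    ultimately have "ray_var i * (F' - ray_var j * H) - ray_var j * (G' - ray_var i * H) \<in> J"
      using J_diff J_mult vi vj by blast
    moreover have "F - G = ray_var i * (F' - ray_var j * H) - ray_var j * (G' - ray_var i * H)"
      unfolding i(3) j(3) by (simp add: algebra_simps)
    ultimately show ?thesis by simp
  qed
qed

section \<open>Reduction to the basis in degree \<open>e\<close>\<close>

definition normal_lift :: "nat \<Rightarrow> 'k mpoly" where
  "normal_lift k = (SOME F. ray_lift (normal e k) F)"

abbreviation "K \<equiv> nat (deg_floor e + 1)"

lemma normal_lift:
  assumes "k < K"
  shows "ray_lift (normal e k) (normal_lift k)" "normal e k \<in> cone 0 e"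
proof -
  show c: "normal e k \<in> cone 0 e" using assms by (intro normal_cone) linarith
  show "ray_lift (normal e k) (normal_lift k)"
    unfolding normal_lift_def using someI_ex[OF exists_ray_lift[OF c]] .
qed

text \<open>The target of the reduction: once it contains every polynomial of degree
  \<open>e\<close>, the independence of the basis makes the coefficients of a relation
  vanish.\<close>

definition normal_span :: "'k mpoly set" where
  "normal_span = {F. \<exists>b. F - (\<Sum>k<K. mpoly_const (b k) * normal_lift k) \<in> J}"

lemma normal_span_J: "F \<in> J \<Longrightarrow> F \<in> normal_span"
  unfolding normal_span_def by (auto intro!: exI[of _ "\<lambda>_. 0"] simp: mpoly_const_def)

lemma normal_span_add:
  assumes "F \<in> normal_span" "G \<in> normal_span"
  shows "F + G \<in> normal_span"
proof -
  obtain b b' where b: "F - (\<Sum>k<K. mpoly_const (b k) * normal_lift k) \<in> J"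
    "G - (\<Sum>k<K. mpoly_const (b' k) * normal_lift k) \<in> J"
    using assms unfolding normal_span_def by blast
  have "F + G - (\<Sum>k<K. mpoly_const (b k + b' k) * normal_lift k) =
    (F - (\<Sum>k<K. mpoly_const (b k) * normal_lift k)) + (G - (\<Sum>k<K. mpoly_const (b' k) * normal_lift k))"
    by (simp add: mpoly_const_def single_add distrib_right sum.distrib)
  also have "\<dots> \<in> J" using b by (rule J_add)
  finally show ?thesis unfolding normal_span_def by (auto intro!: exI[of _ "\<lambda>k. b k + b' k"])
qed

lemma normal_span_const:
  assumes "F \<in> normal_span"
  shows "mpoly_const a * F \<in> normal_span"
proof -
  obtain b where b: "F - (\<Sum>k<K. mpoly_const (b k) * normal_lift k) \<in> J"
    using assms unfolding normal_span_def by blast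
  have "mpoly_const a * F - (\<Sum>k<K. mpoly_const (a * b k) * normal_lift k) =
    mpoly_const a * (F - (\<Sum>k<K. mpoly_const (b k) * normal_lift k))"
    by (simp add: mpoly_const_def right_diff_distrib sum_distrib_left mult_single flip: mult.assoc)
  also have "\<dots> \<in> J" using b by (rule J_const)
  finally show ?thesis unfolding normal_span_def by (auto intro!: exI[of _ "\<lambda>k. a * b k"])
qed

lemma normal_span_cong:
  assumes "F - G \<in> J" "G \<in> normal_span"
  shows "F \<in> normal_span"
  using normal_span_add[OF normal_span_J[OF assms(1)] assms(2)] by simp

lemma normal_lift_span:
  assumes "k < K"
  shows "normal_lift k \<in> normal_span"
proof -
  have "(\<Sum>j<K. mpoly_const (if j = k then 1 else 0) * normal_lift j) = (\<Sum>j<K. if j = k then normal_lift j else 0)"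
    by (intro sum.cong) (auto simp: mpoly_const_def)
  also have "\<dots> = normal_lift k" using assms by simp
  finally show ?thesis
    unfolding normal_span_def by (auto intro!: exI[of _ "\<lambda>j. if j = k then 1 else 0"] simp: J_zero)
qed

text \<open>Only two exponents are left free and their sum is determined; \<open>k\<close> is the
  floored slack at \<open>i\<^sub>0\<close>.\<close>

lemma cone_eq_normal:
  assumes c: "c \<in> cone 0 e" and min: "\<And>i. i \<in> {1..n} - {i\<^sub>0, j\<^sub>0} \<Longrightarrow> c i = - flr e i"
  shows "\<exists>k<K. c = normal e k"
proof -
  have pos: "c i + flr e i \<ge> 0" if "i \<in> {1..n}" for i
    using c that unfolding cone_def slack_iff by blast
  define k where "k = nat (c i\<^sub>0 + flr e i\<^sub>0)"
  have k: "int k = c i\<^sub>0 + flr e i\<^sub>0" using pos[OF i0(1)] by (simp add: k_def)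
  have "(\<Sum>i=1..n. c i + flr e i) = (\<Sum>i\<in>{i\<^sub>0, j\<^sub>0}. c i + flr e i)"
    by (rule sum.mono_neutral_right) (use i0(1) j0(1) min in auto)
  also have "\<dots> = int k + (c j\<^sub>0 + flr e j\<^sub>0)" using j0(2) k by auto
  finally have k': "deg_floor e = int k + (c j\<^sub>0 + flr e j\<^sub>0)"
    using c by (simp add: sum.distrib cone_def deg_floor_def)
  then have "k < K" using pos[OF j0(1)] by linarith
  moreover have "c i = normal e k i" for i
  proof (cases "i \<in> {1..n}")
    case True
    then show ?thesis using min[of i] k k' j0(2) unfolding normal_def by auto
  next
    case False
    then have "c i = 0" using c unfolding cone_def by blast
    then show ?thesis using False i0(1) j0(1) unfolding normal_def by auto
  qed
  ultimately show ?thesis by blast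
qed

text \<open>Induction on the total floored slack outside \<open>i\<^sub>0\<close> and
  \<open>j\<^sub>0\<close>. One factor \<open>s i\<close> with positive slack is replaced by a
  combination of \<open>s i\<^sub>0\<close> and \<open>s j\<^sub>0\<close>; an edge vector is split
  off first, so that the replacement takes place in degree below \<open>e\<close>.\<close>

lemma ray_lift_span:
  assumes "c \<in> cone 0 e" "ray_lift c F"
  shows "F \<in> normal_span"
  using assms
proof (induction "nat (\<Sum>i\<in>{1..n} - {i\<^sub>0, j\<^sub>0}. c i + flr e i)" arbitrary: c F rule: less_induct)
  case less
  note c = less.prems(1)
  have pos: "c i + flr e i \<ge> 0" if "i \<in> {1..n}" for i
    using c that unfolding cone_def slack_iff by blast
  show ?case
  proof (cases "\<forall>i\<in>{1..n} - {i\<^sub>0, j\<^sub>0}. c i = - flr e i")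
    case True
    then obtain k where k: "k < K" "c = normal e k" using cone_eq_normal[OF c] by blast
    have "F - normal_lift k \<in> J"
      using ray_lift_unique[OF c less.prems(2)] normal_lift(1)[OF k(1)] k(2) by blast
    then show ?thesis using normal_lift_span[OF k(1)] by (rule normal_span_cong)
  next
    case False
    then obtain i where i: "i \<in> {1..n}" "i \<noteq> i\<^sub>0" "i \<noteq> j\<^sub>0" "c i \<noteq> - flr e i" by blast
    \<comment> \<open>The common factor of the three terms of the linear relation, with exponents
      summing to \<open>-1\<close>.\<close>
    define c' where "c' = (\<lambda>j. c j - unit i j)"
    have c'_add: "(\<lambda>j. c' j + unit i j) = c" by (simp add: c'_def)
    have c': "c' \<in> cone 1 e"
    proof -
      have "c' j + flr e j \<ge> 0" if "j \<in> {1..n}" for j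
        using pos[OF that] i(4) by (auto simp: c'_def unit_def)
      moreover have "(\<Sum>j=1..n. c' j) = - int 1"
        using c i(1) by (simp add: c'_def sum_subtractf unit_def cone_def)
      moreover have "c' j = 0" if "j \<notin> {1..n}" for j
        using c that i(1) by (auto simp: c'_def unit_def cone_def)
      ultimately show ?thesis unfolding cone_def slack_iff by blast
    qed
    \<comment> \<open>With sum \<open>-1\<close> this requires \<open>B + l \<le> e\<close>.\<close>
    obtain r where r: "reducible r e c'" using exists_reducible[OF c'] e_bounds(2) by auto
    note Lr = L_reducible[OF c' r]
    have cr: "sub_ray r c' \<in> cone 1 (e - L r)" by (rule sub_ray_cone[OF c' r])
    \<comment> \<open>An edge vector that splits off from the common factor splits off from all
      three terms.\<close>
    have red: "reducible r e (\<lambda>j. c' j + unit a j)" for a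
    proof -
      have "rat_of_int (unit a r) \<ge> 0" by (simp add: unit_def)
      then show ?thesis using r unfolding reducible_def of_int_add by linarith
    qed
    have sub: "sub_ray r (\<lambda>j. c' j + unit a j) = (\<lambda>j. sub_ray r c' j + unit a j)" for a
      by (auto simp: sub_ray_def)
    have cone_low: "(\<lambda>j. sub_ray r c' j + unit a j) \<in> cone 0 (e - L r)" if "a \<in> {1..n}" for a
      by (rule cone_add_unit) (use cr that in simp_all)
    have cone_e: "(\<lambda>j. c' j + unit a j) \<in> cone 0 e" if "a \<in> {1..n}" for a
      by (rule cone_add_unit) (use c' that in simp_all)
    have "\<exists>X. lift (e - L r) (\<lambda>j. sub_ray r c' j + unit a j) X" if "a \<in> {1..n}" for a
      by (rule exists_lift[OF cone_low[OF that]])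
    then obtain X where X: "\<And>a. a \<in> {1..n} \<Longrightarrow> lift (e - L r) (\<lambda>j. sub_ray r c' j + unit a j) (X a)"
      by metis
    have ray: "ray_lift (\<lambda>j. c' j + unit a j) (ray_var r * X a)" if "a \<in> {1..n}" for a
      by (rule ray_liftI[OF red]) (use X[OF that] sub in simp)
    have span: "ray_var r * X a \<in> normal_span" if a: "a = i\<^sub>0 \<or> a = j\<^sub>0" for a
    proof (rule less.hyps)
      have a': "a \<in> {1..n}" using a i0(1) j0(1) by blast
      show "(\<lambda>j. c' j + unit a j) \<in> cone 0 e" "ray_lift (\<lambda>j. c' j + unit a j) (ray_var r * X a)"
        using cone_e ray a' by blast+
      let ?S = "{1..n} - {i\<^sub>0, j\<^sub>0}"
      \<comment> \<open>The set \<open>?S\<close> contains \<open>i\<close> but not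
        \<open>a\<close>, so the measure drops by exactly \<open>1\<close>.\<close>
      have "(\<Sum>j\<in>?S. c' j + unit a j + flr e j) = (\<Sum>j\<in>?S. (c j + flr e j) - unit i j)"
        by (rule sum.cong) (use a in \<open>auto simp: c'_def unit_def\<close>)
      also have "\<dots> = (\<Sum>j\<in>?S. c j + flr e j) - 1"
        using i by (simp add: sum_subtractf unit_def)
      finally have eq: "(\<Sum>j\<in>?S. c' j + unit a j + flr e j) = (\<Sum>j\<in>?S. c j + flr e j) - 1" .
      have "0 \<le> (\<Sum>j\<in>?S. c' j + unit a j + flr e j)"
        by (rule sum_nonneg) (use cone_e[OF a'] in \<open>unfold cone_def slack_iff, blast\<close>)
      then show "nat (\<Sum>j\<in>?S. c' j + unit a j + flr e j) < nat (\<Sum>j\<in>?S. c j + flr e j)"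
        unfolding eq by linarith
    qed
    obtain b b' where b: "s i = fconst b * s i\<^sub>0 + fconst b' * s j\<^sub>0" using s_linear[OF i(1)] by blast
    let ?G = "mpoly_const b * X i\<^sub>0 + mpoly_const b' * X j\<^sub>0"
    \<comment> \<open>This is the linear relation for \<open>s i\<close> multiplied by
      \<open>z (sub_ray r c')\<close>.\<close>
    have "X i - ?G \<in> relations (e - L r)"
    proof -
      have "\<phi> (X a) = Polynomial.monom (s a * z (sub_ray r c')) (e - L r)" if "a \<in> {1..n}" for a
        using X[OF that] z_add_unit[OF that] by (simp add: lift_def)
      then have "\<phi> (X i - ?G) = 0"
        using i(1) i0(1) j0(1)
        by (simp add: eval_diff eval_add eval_mult eval_const b smult_monom add_monom distrib_right mult.assoc)
      moreover have "X i - ?G \<in> mpoly_piece N w (e - L r)"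
        using X[OF i(1)] X[OF i0(1)] X[OF j0(1)] unfolding lift_def
        by (intro mpoly_piece_diff mpoly_piece_add mpoly_piece_const_mult) blast+
      ultimately show ?thesis unfolding relations_def by blast
    qed
    then have "X i - ?G \<in> J" using J_low[OF Lr(4)] by blast
    then have "ray_var r * (X i - ?G) \<in> J"
      using J_mult lift_mpolys[OF lift_ray_var[OF Lr(1)]] by blast
    then have 1: "ray_var r * X i - (mpoly_const b * (ray_var r * X i\<^sub>0) + mpoly_const b' * (ray_var r * X j\<^sub>0)) \<in> J"
      by (simp add: algebra_simps)
    have "mpoly_const b * (ray_var r * X i\<^sub>0) + mpoly_const b' * (ray_var r * X j\<^sub>0) \<in> normal_span"
      using span by (intro normal_span_add normal_span_const) auto
    with 1 have "ray_var r * X i \<in> normal_span" by (rule normal_span_cong)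
    moreover have "F - ray_var r * X i \<in> J"
      using ray_lift_unique[OF c less.prems(2)] ray[OF i(1)] unfolding c'_add by blast
    ultimately show ?thesis using normal_span_cong by blast
  qed
qed

text \<open>Remove one variable of positive weight. The rest has degree below \<open>e\<close>, yet
  at least \<open>B\<close>, because the removed weight is less than \<open>B\<close> and
  \<open>2 * B \<le> e\<close>. So an edge vector splits off from the rest, with an error in
  \<open>J\<close>.\<close>

lemma monomial_ray_lift:
  assumes m: "Poly_Mapping.keys m \<subseteq> {..<N}" "weight w m = e"
  shows "\<exists>c F. c \<in> cone 0 e \<and> ray_lift c F \<and> Poly_Mapping.single m 1 - F \<in> J"
proof -
  have "weight w m > 0" using m(2) e_bounds(1) B_pos by linarith
  moreover have "weight w m = 0" if "\<forall>j\<in>Poly_Mapping.keys m. w j = 0"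
    unfolding weight_def by (rule sum.neutral) (use that in simp)
  ultimately have "\<not> (\<forall>j\<in>Poly_Mapping.keys m. w j = 0)" by linarith
  \<comment> \<open>Removing a variable of weight \<open>0\<close> would leave the degree at
    \<open>e\<close>, outside the range where relations are known to lie in
    \<open>J\<close>.\<close>
  then obtain j where j: "j \<in> Poly_Mapping.keys m" "w j > 0" by auto
  then have jN: "j < N" using m(1) by auto
  define m' where "m' = m - Poly_Mapping.single j 1"
  have mm': "m = Poly_Mapping.single j 1 + m'"
    by (rule poly_mapping_eqI) (use j(1) in \<open>auto simp: m'_def lookup_add lookup_minus lookup_single when_def in_keys_iff\<close>)
  have keys': "Poly_Mapping.keys m' \<subseteq> {..<N}"
  proof -
    have "Poly_Mapping.keys m' \<subseteq> Poly_Mapping.keys m"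
      by (auto simp: m'_def in_keys_iff lookup_minus)
    then show ?thesis using m(1) by blast
  qed
  have wm: "e = w j + weight w m'" using m(2) unfolding mm' by (simp add: weight_add)
  define d where "d = weight w m'"
  have e_eq: "e = w j + d" using wm by (simp add: d_def)
  have d: "d < e" "B \<le> d" using e_eq j(2) gen_cone(2)[OF jN] e_bounds(1) by linarith+
  obtain c' where c': "c' \<in> cone 0 d" "monomial_eval gval m' = Polynomial.monom (z c') d"
    using monomial_value[OF keys'] unfolding d_def by blast
  have lift': "lift d c' (Poly_Mapping.single m' 1)"
    using c'(2) keys' by (simp add: lift_def \<phi>_single mpoly_piece_single d_def)
  obtain i where i: "reducible i d c'" using exists_reducible[OF c'(1)] d(2) by auto
  note Li = L_reducible[OF c'(1) i]
  obtain F' where F': "lift (d - L i) (sub_ray i c') F'"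
    using exists_lift[OF sub_ray_cone[OF c'(1) i]] by blast
  let ?x = "Poly_Mapping.single (Poly_Mapping.single j 1) 1 :: 'k mpoly"
  let ?c = "\<lambda>k. snd (gen j) k + c' k"
  have x: "lift (w j) (snd (gen j)) ?x" by (rule lift_variable[OF jN])
  have c: "?c \<in> cone 0 e" using cone_add[OF gen_cone(1)[OF jN] c'(1)] by (simp add: e_eq)
  have sub: "sub_ray i ?c = (\<lambda>k. snd (gen j) k + sub_ray i c' k)"
    by (auto simp: sub_ray_def)
  have deg: "e - L i = w j + (d - L i)" using e_eq Li(3) by simp
  have "reducible i e ?c"
  proof -
    have "of_int (snd (gen j) i) + of_nat (w j) * \<alpha> i \<ge> 0"
      using gen_cone(1)[OF jN] Li(1) unfolding cone_def by blast
    then show ?thesis using i unfolding reducible_def by (simp add: e_eq algebra_simps)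
  qed
  moreover have "lift (e - L i) (sub_ray i ?c) (?x * F')"
    unfolding sub deg by (rule lift_mult[OF x F'])
  ultimately have ray: "ray_lift ?c (ray_var i * (?x * F'))" by (rule ray_liftI)
  have "Poly_Mapping.single m' 1 - ray_var i * F' \<in> J"
    by (rule lift_unique_low[OF d(1) lift' lift_ray_mult[OF c'(1) i F']])
  then have "?x * (Poly_Mapping.single m' 1 - ray_var i * F') \<in> J"
    using J_mult lift_mpolys[OF x] by blast
  moreover have "?x * Poly_Mapping.single m' 1 = Poly_Mapping.single m 1"
    unfolding mm' by (simp add: mult_single)
  ultimately have "Poly_Mapping.single m 1 - ray_var i * (?x * F') \<in> J"
    by (simp add: right_diff_distrib mult.left_commute)
  with c ray show ?thesis by blast
qed

lemma piece_span:
  assumes "f \<in> mpoly_piece N w e"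
  shows "f \<in> normal_span"
  using assms
proof (induction rule: mpoly_piece_induct)
  case zero
  show ?case by (rule normal_span_J[OF J_zero])
next
  case (add f f')
  then show ?case by (rule normal_span_add)
next
  case (single m b)
  obtain c F where "c \<in> cone 0 e" "ray_lift c F" "Poly_Mapping.single m 1 - F \<in> J"
    using monomial_ray_lift[OF single] by blast
  then have "Poly_Mapping.single m 1 \<in> normal_span"
    using ray_lift_span normal_span_cong by blast
  then show ?case unfolding single_conv_const_mult[of m b] by (rule normal_span_const)
qed

text \<open>Modulo \<open>J\<close> a relation is a combination of lifts of basis elements. Applying
  \<open>\<phi>\<close> turns it into a vanishing combination of independent elements, so the
  coefficients are zero and the relation itself lies in \<open>J\<close>.\<close>

lemma relations_subset_J: "relations e \<subseteq> J"
proof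
  fix f assume "f \<in> relations e"
  then have f: "f \<in> mpoly_piece N w e" "\<phi> f = 0" by (auto simp: relations_def)
  obtain b where b: "f - (\<Sum>k<K. mpoly_const (b k) * normal_lift k) \<in> J"
    using piece_span[OF f(1)] unfolding normal_span_def by blast
  have "\<phi> (normal_lift k) = Polynomial.monom (z (normal e k)) e" if "k < K" for k
    using ray_lift_lift[OF normal_lift(2)[OF that] normal_lift(1)[OF that]] by (simp add: lift_def)
  then have "\<phi> (\<Sum>k<K. mpoly_const (b k) * normal_lift k) =
      (\<Sum>k<K. Polynomial.monom (fconst (b k) * z (normal e k)) e)"
    unfolding eval_sum by (intro sum.cong) (simp_all add: eval_mult eval_const smult_monom)
  also have "\<dots> = Polynomial.monom (\<Sum>k<K. fconst (b k) * z (normal e k)) e"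
    by (simp add: monom_sum)
  finally have "Polynomial.monom (\<Sum>k<K. fconst (b k) * z (normal e k)) e = 0"
    using J_kernel[OF b] f(2) by (simp add: eval_diff)
  then have "(\<Sum>k<K. fconst (b k) * z (normal e k)) = 0" by (simp only: monom_eq_0_iff)
  from normal_independent[OF this] have "b k = 0" if "k < K" for k using that by blast
  then have "(\<Sum>k<K. mpoly_const (b k) * normal_lift k) = 0"
    by (intro sum.neutral) (simp add: mpoly_const_def)
  with b show "f \<in> J" by simp
qed

end


section \<open>The graded presentation\<close>

lemma canonical_ring_ops [simp]:
  "mult (canonical_ring D) = (*)" "one (canonical_ring D) = 1" "zero (canonical_ring D) = 0"
  "add (canonical_ring D) = (+)"
  by (simp_all add: canonical_ring_def ring_on_def)

lemma canonical_ring_iff: "F \<in> carrier (canonical_ring D) \<longleftrightarrow> (\<forall>d. coeff F d \<in> H0 (floor_multiple d D))"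
  by (simp add: canonical_ring_def ring_on_def)

lemma canonical_piece_ring: "canonical_piece D d \<subseteq> carrier (canonical_ring D)"
  by (auto simp: canonical_piece_def canonical_ring_iff H0_zero)

context canonical_generators
begin

definition relation_set :: "'k mpoly set" where
  "relation_set = (\<Union>e<bound. relations e)"

abbreviation relation_ideal_gen :: "'k mpoly set" ("\<I>") where
  "\<I> \<equiv> Idl\<^bsub>mpoly_ring N\<^esub> relation_set"

lemma \<phi>_carrier:
  assumes "f \<in> mpolys N"
  shows "\<phi> f \<in> carrier (canonical_ring D)"
proof -
  obtain E F where EF: "finite E" "f = (\<Sum>e\<in>E. F e)" "\<And>e. F e \<in> mpoly_piece N w e"
    using mpoly_homogeneous_decomposition[OF assms, where w = w] by blast
  have "\<phi> (F e) \<in> carrier (canonical_ring D)" for e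
    using \<phi>_piece[OF EF(3)] canonical_piece_ring by blast
  then show ?thesis
    by (simp add: EF(2) eval_sum canonical_ring_iff coeff_sum H0_sum)
qed

lemma \<phi>_hom: "\<phi> \<in> ring_hom (mpoly_ring N) (canonical_ring D)"
  by (rule ring_hom_memI) (simp_all add: \<phi>_carrier eval_mult eval_add eval_one)

lemma \<phi>_ring_hom_ring: "ring_hom_ring (mpoly_ring N) (canonical_ring D) \<phi>"
  by (intro ring_hom_ringI2 cring.axioms(1) cring_mpoly_ring cring_canonical_ring \<phi>_hom)

lemma \<phi>_surj: "\<phi> ` mpolys N = carrier (canonical_ring D)"
proof
  show "\<phi> ` mpolys N \<subseteq> carrier (canonical_ring D)" using \<phi>_carrier by blast
  show "carrier (canonical_ring D) \<subseteq> \<phi> ` mpolys N"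
  proof
    fix F assume F: "F \<in> carrier (canonical_ring D)"
    have "\<exists>f\<in>mpoly_piece N w e. \<phi> f = Polynomial.monom (coeff F e) e" for e
      using F by (intro \<phi>_surj_piece) (auto simp: canonical_piece_def canonical_ring_iff)
    then obtain f where f: "\<And>e. f e \<in> mpoly_piece N w e" "\<And>e. \<phi> (f e) = Polynomial.monom (coeff F e) e"
      by metis
    have "F = \<phi> (\<Sum>e\<le>degree F. f e)"
      by (simp add: eval_sum f(2) poly_as_sum_of_monoms)
    moreover have "(\<Sum>e\<le>degree F. f e) \<in> mpolys N"
      using f(1) unfolding mpolys_iff mpoly_piece_iff using keys_sum[of f "{..degree F}"] by blast
    ultimately show "F \<in> \<phi> ` mpolys N" by blast
  qed
qed

lemma relation_set_kernel: "relation_set \<subseteq> a_kernel (mpoly_ring N) (canonical_ring D) \<phi>"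
  using mpoly_piece_mpolys by (fastforce simp: relation_set_def relations_def a_kernel_def')

lemma kernel_ideal: "ideal (a_kernel (mpoly_ring N) (canonical_ring D) \<phi>) (mpoly_ring N)"
  by (rule ring_hom_ring.kernel_is_ideal[OF \<phi>_ring_hom_ring])

lemma ring_mpoly_ring: "ring (mpoly_ring N)"
  by (rule cring.axioms(1)[OF cring_mpoly_ring])

lemma relation_set_mpolys: "relation_set \<subseteq> mpolys N"
  using mpoly_piece_mpolys by (fastforce simp: relation_set_def relations_def)

lemma ideal_\<I>: "ideal \<I> (mpoly_ring N)"
  by (rule ring.genideal_ideal[OF ring_mpoly_ring relation_set_mpolys])

lemma \<I>_kernel: "\<I> \<subseteq> a_kernel (mpoly_ring N) (canonical_ring D) \<phi>"
  by (rule ring.genideal_minimal[OF ring_mpoly_ring kernel_ideal relation_set_kernel])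

lemma \<I>_zero: "0 \<in> \<I>"
  using additive_subgroup.zero_closed[OF ideal.axioms(1)[OF ideal_\<I>]] by simp

lemma \<I>_add: "a \<in> \<I> \<Longrightarrow> b \<in> \<I> \<Longrightarrow> a + b \<in> \<I>"
  using additive_subgroup.a_closed[OF ideal.axioms(1)[OF ideal_\<I>]] by simp

lemma \<I>_mult: "a \<in> mpolys N \<Longrightarrow> b \<in> \<I> \<Longrightarrow> a * b \<in> \<I>"
  using ideal.I_l_closed[OF ideal_\<I>] by simp

text \<open>Below \<open>bound\<close> the relations are generators of the ideal; from
  \<open>bound\<close> on, the inductive step applies with the ideal itself as
  \<open>J\<close>.\<close>

lemma relations_\<I>: "relations e \<subseteq> \<I>"
proof (induction e rule: less_induct)
  case (less e)
  show ?case
  proof (cases "e < bound")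
    case True
    then have "relations e \<subseteq> relation_set" by (auto simp: relation_set_def)
    also have "\<dots> \<subseteq> \<I>" by (rule ring.genideal_self[OF ring_mpoly_ring relation_set_mpolys])
    finally show ?thesis .
  next
    case False
    interpret relation_ideal n P \<alpha> i\<^sub>0 j\<^sub>0 L l N gen \<I> e
      by unfold_locales (use \<I>_zero \<I>_add \<I>_mult \<I>_kernel less False in \<open>auto simp: a_kernel_def'\<close>)
    show ?thesis by (rule relations_subset_J)
  qed
qed

text \<open>The values of the homogeneous components lie in different powers of \<open>u\<close>, so
  each component of a kernel element is a relation on its own.\<close>

lemma kernel_eq: "a_kernel (mpoly_ring N) (canonical_ring D) \<phi> = \<I>"
proof
  show "a_kernel (mpoly_ring N) (canonical_ring D) \<phi> \<subseteq> \<I>"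
  proof
    fix f assume "f \<in> a_kernel (mpoly_ring N) (canonical_ring D) \<phi>"
    then have f: "f \<in> mpolys N" "\<phi> f = 0" by (simp_all add: a_kernel_def')
    obtain E F where EF: "finite E" "f = (\<Sum>e\<in>E. F e)" "\<And>e. F e \<in> mpoly_piece N w e"
      using mpoly_homogeneous_decomposition[OF f(1), where w = w] by blast
    have "\<exists>a. \<phi> (F e) = Polynomial.monom a e" for e
      using \<phi>_piece[OF EF(3)] unfolding canonical_piece_def by blast
    then obtain a where a: "\<And>e. \<phi> (F e) = Polynomial.monom (a e) e" by metis
    have "a e = 0" if "e \<in> E" for e
    proof -
      have "0 = coeff (\<phi> f) e" using f(2) by simp
      also have "\<dots> = (\<Sum>e'\<in>E. if e' = e then a e' else 0)"
        by (simp add: EF(2) eval_sum a coeff_sum)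
      also have "\<dots> = a e" using that EF(1) by simp
      finally show ?thesis by simp
    qed
    then have "F e \<in> relations e" if "e \<in> E" for e
      using that EF(3) a by (simp add: relations_def)
    then have "F e \<in> \<I>" if "e \<in> E" for e
      using relations_\<I> that by blast
    then have "(\<Sum>e\<in>A. F e) \<in> \<I>" if "A \<subseteq> E" for A
      using that by (induction A rule: infinite_finite_induct) (auto simp: \<I>_zero \<I>_add)
    then show "f \<in> \<I>" using EF(2) by blast
  qed
qed (rule \<I>_kernel)

text \<open>The first isomorphism theorem: \<open>the_elem\<close> extracts the common value of
  \<open>\<phi>\<close> on a coset.\<close>

lemma graded_iso: "(\<lambda>X. the_elem (\<phi> ` X)) \<in> graded_isos N w \<I> D"
proof -
  have coset: "the_elem (\<phi> ` (\<I> +>\<^bsub>mpoly_ring N\<^esub> f)) = \<phi> f" for f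
  proof -
    have "\<phi> (a + f) = \<phi> f" if "a \<in> \<I>" for a
      using that \<I>_kernel by (auto simp: eval_add a_kernel_def')
    then have "\<phi> ` (\<I> +>\<^bsub>mpoly_ring N\<^esub> f) = {\<phi> f}"
      using \<I>_zero unfolding a_r_coset_def' by force
    then show ?thesis by simp
  qed
  have "(\<lambda>X. the_elem (\<phi> ` X)) \<in> ring_iso (mpoly_ring N Quot \<I>) (canonical_ring D)"
    using ring_hom_ring.FactRing_iso_set[OF \<phi>_ring_hom_ring] \<phi>_surj unfolding kernel_eq by simp
  moreover have "\<phi> ` mpoly_piece N w e = canonical_piece D e" for e
    using \<phi>_piece \<phi>_surj_piece by blast
  ultimately show ?thesis
    by (simp add: graded_isos_def coset eval_const to_fract_def)
qed

end

section \<open>Degrees of generators and relations\<close>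

theorem theorem8:
  fixes n :: nat
    and P :: "nat \<Rightarrow> 'k::field poly place"
    and \<alpha> :: "nat \<Rightarrow> rat"
    and p :: "nat \<Rightarrow> int"
    and q L :: "nat \<Rightarrow> nat"
    and l :: nat
  assumes "n \<ge> 2"
    and "inj_on P {1..n}"
    and "\<And>i. i \<in> {1..n} \<Longrightarrow> P i \<in> rational_points"
    and "(\<Sum>i=1..n. \<alpha> i) > 0"
    and "\<And>i. i \<in> {1..n} \<Longrightarrow> q i > 0"
    and "\<And>i. i \<in> {1..n} \<Longrightarrow> coprime (p i) (int (q i))"
    and "\<And>i. i \<in> {1..n} \<Longrightarrow> \<alpha> i = of_int (p i) / of_nat (q i)"
    and "l = (LCM j\<in>{1..n}. q j)"
    and "\<And>i. i \<in> {1..n} \<Longrightarrow> L i = (LCM j\<in>{1..n} - {i}. q j)"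
  shows "\<exists>N w R h.
    (\<forall>j<N. w j < (\<Sum>i=1..n. L i)) \<and>
    (\<forall>r\<in>R. \<exists>e < max (l + (\<Sum>i=1..n. L i)) (2 * (\<Sum>i=1..n. L i)). r \<in> mpoly_piece N w e) \<and>
    h \<in> graded_isos N w (Idl\<^bsub>mpoly_ring N\<^esub> R) (point_divisor n P \<alpha>)"
proof -
  have int: "of_nat m * \<alpha> j \<in> \<int>" if j: "j \<in> {1..n}" and dvd: "q j dvd m" for m j
  proof -
    obtain k where "m = q j * k" using dvd by (elim dvdE)
    then have "of_nat m * \<alpha> j = of_int (int k * p j)"
      using assms(5,7)[OF j] by simp
    then show ?thesis by (simp only: Ints_of_int)
  qed
  have lcm_pos: "(LCM j\<in>A. q j) > 0" if "A \<subseteq> {1..n}" for A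
  proof -
    have "finite (q ` A)" using that finite_subset by blast
    moreover have "0 \<notin> q ` A" using that assms(5) by force
    ultimately show ?thesis by (metis Lcm_0_iff_nat gr0I)
  qed
  \<comment> \<open>Since \<open>l\<close> clears all denominators, \<open>l\<close> times the
    degree is an integer; being positive, it is at least \<open>1\<close>.\<close>
  have "of_nat l * (\<Sum>i=1..n. \<alpha> i) \<in> \<int>"
    unfolding sum_distrib_left assms(8) by (intro Ints_sum int) (auto intro: dvd_Lcm)
  then obtain k where k: "of_nat l * (\<Sum>i=1..n. \<alpha> i) = of_int k" by (elim Ints_cases)
  moreover have "of_nat l * (\<Sum>i=1..n. \<alpha> i) > 0"
    using assms(4) lcm_pos[of "{1..n}"] unfolding assms(8) by (intro mult_pos_pos) (simp_all only: of_nat_0_less_iff order_refl)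
  ultimately have l_deg: "of_nat l * (\<Sum>i=1..n. \<alpha> i) \<ge> 1" by simp

  \<comment> \<open>At most one of the distinct points \<open>P 1\<close> and \<open>P 2\<close> is
    infinity; \<open>i\<^sub>0\<close> is the index of a finite one.\<close>
  define i\<^sub>0 :: nat where "i\<^sub>0 = (if P 1 = Infinite_Place then 2 else 1)"
  define j\<^sub>0 :: nat where "j\<^sub>0 = (if P 1 = Infinite_Place then 1 else 2)"
  have 12: "1 \<in> {1..n}" "2 \<in> {1..n}" using assms(1) by simp_all
  then have "P 1 \<noteq> P 2" using inj_onD[OF assms(2), of 1 2] by auto
  then have i0: "i\<^sub>0 \<in> {1..n}" "P i\<^sub>0 \<noteq> Infinite_Place" and j0: "j\<^sub>0 \<in> {1..n}" "j\<^sub>0 \<noteq> i\<^sub>0"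
    using 12 by (auto simp: i\<^sub>0_def j\<^sub>0_def)
  interpret positive_divisor n P \<alpha> i\<^sub>0 j\<^sub>0 L l
  proof
    show "0 < L i" if "i \<in> {1..n}" for i
      unfolding assms(9)[OF that] by (rule lcm_pos) blast
    show "of_nat (L i) * \<alpha> j \<in> \<int>" if "i \<in> {1..n}" "j \<in> {1..n}" "i \<noteq> j" for i j
      unfolding assms(9)[OF that(1)] using that by (intro int dvd_Lcm) auto
  qed (use assms(2,3) i0 j0 l_deg in blast)+
  \<comment> \<open>There are finitely many degrees and finitely many lattice points in each;
    numbering them gives the variables.\<close>
  have "{(d, c). d < B \<and> c \<in> cone 0 d} = (SIGMA d:{..<B}. cone 0 d)" by auto
  then have "finite {(d, c). d < B \<and> c \<in> cone 0 d}" using finite_cone by simp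
  then obtain N gen where gen: "gen ` {..<N::nat} = {(d, c). d < B \<and> c \<in> cone 0 d}"
    by (auto dest!: finite_imp_nat_seg_image_inj_on simp: lessThan_def)
  then interpret canonical_generators n P \<alpha> i\<^sub>0 j\<^sub>0 L l N gen
    by unfold_locales (rule gen)
  have "w j < (\<Sum>i=1..n. L i)" if "j < N" for j
    using gen_cone(2)[OF that] by (simp add: B_def)
  moreover have "\<exists>e < max (l + (\<Sum>i=1..n. L i)) (2 * (\<Sum>i=1..n. L i)). r \<in> mpoly_piece N w e"
    if "r \<in> relation_set" for r
    using that by (auto simp: relation_set_def relations_def bound_def B_def)
  ultimately show ?thesis using graded_iso by blast
qed

end
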